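(* Let $L/K$ be a finite separable field extension and let $G$ be a semisimple linear algebraic group defined over $K$. Let $Z_1\subseteq Z_2\subseteq G$ be central subgroups. If the $H^1$-variant of the norm principle holds for the pair $(Z_2,G)$ over $L/K$, then the $H^1$-variant of the norm principle holds for the pair $(Z_1,G)$ over $L/K$.
   Context: For a semisimple group $S$ over $K$ and a central subgroup $Z\subseteq S$, let $\alpha_L:H^1(L,Z)\to H^1(L,S)$ and $\alpha_K:H^1(K,Z)\to H^1(K,S)$ be induced by the inclusion in Galois cohomology. The $H^1$-variant of the norm principle holds for $(Z,S)$ over $L/K$ if $\mathrm{cor}_{L/K}(\ker\alpha_L)\subseteq\ker\alpha_K$, where $\mathrm{cor}_{L/K}:H^1(L,Z)\to H^1(K,Z)$ is the corestriction map. *)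

theory Defs
  imports
    "HOL-Analysis.Analysis"
    "HOL-Algebra.Algebra"
    "HOL-Algebra.Algebraic_Closure_Type"
    "HOL-Library.Poly_Mapping"
begin

text \<open>
  Conventions.  The type \<open>'a\<close> is the underlying set of an algebraic closure of the base field
  \<open>K\<close>, and all fields that occur are subfields of it.  Linear algebraic groups are taken in the
  classical sense: Zariski closed subgroups of some \<open>GL\<^sub>n\<close> over the algebraic closure, defined
  over \<open>K\<close>.  The size \<open>n\<close> is \<open>CARD('n)\<close>.
\<close>

no_notation fps_nth (infixl "$" 75)

section \<open>Fields\<close>

abbreviation FR :: "'a::field ring" where
  "FR \<equiv> ring_of_type_algebra"

definition polys_over :: "'a::field set \<Rightarrow> 'a poly set" where
  "polys_over K = {p. \<forall>i. poly.coeff p i \<in> K}"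

definition is_minpoly :: "'a::field set \<Rightarrow> 'a \<Rightarrow> 'a poly \<Rightarrow> bool" where
  "is_minpoly K x p \<longleftrightarrow>
     p \<in> polys_over K \<and> Polynomial.lead_coeff p = 1 \<and> poly p x = 0 \<and>
     (\<forall>q\<in>polys_over K. q \<noteq> 0 \<and> poly q x = 0 \<longrightarrow> Polynomial.degree p \<le> Polynomial.degree q)"

text \<open>
  The predicate \<open>rsquarefree\<close> refers to roots in \<open>'a\<close>, so below it says that the minimal polynomial
  has only simple roots in the algebraic closure.
\<close>

definition separable_over :: "'a::field set \<Rightarrow> 'a \<Rightarrow> bool" where
  "separable_over K x \<longleftrightarrow> (\<exists>p. is_minpoly K x p \<and> rsquarefree p)"

definition finite_separable_extension :: "'a::field set \<Rightarrow> 'a set \<Rightarrow> bool" where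
  "finite_separable_extension K L \<longleftrightarrow>
     subfield K FR \<and> subfield L FR \<and> K \<subseteq> L \<and>
     ring.finite_dimension FR K L \<and> (\<forall>x\<in>L. separable_over K x)"

text \<open>
  A separable algebraic extension of \<open>K\<close> that is separably closed.  It lies inside the algebraic
  closure \<open>'a\<close>, so it suffices to test separable closedness on the elements of \<open>'a\<close>.
\<close>

definition is_separable_closure :: "'a::field set \<Rightarrow> 'a set \<Rightarrow> bool" where
  "is_separable_closure K \<Omega> \<longleftrightarrow>
     subfield K FR \<and> subfield \<Omega> FR \<and> K \<subseteq> \<Omega> \<and>
     (\<forall>x\<in>\<Omega>. separable_over K x) \<and> (\<forall>x. separable_over \<Omega> x \<longrightarrow> x \<in> \<Omega>)"

section \<open>Linear algebraic groups\<close>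

text \<open>Polynomials in the matrix entries; the variable \<open>(i, j)\<close> stands for the entry \<open>A $ i $ j\<close>.\<close>

type_synonym ('a, 'n) mat_poly = "(('n \<times> 'n) \<Rightarrow>\<^sub>0 nat) \<Rightarrow>\<^sub>0 'a"

definition mat_poly_eval :: "('a::field, 'n::finite) mat_poly \<Rightarrow> 'a ^ 'n ^ 'n \<Rightarrow> 'a" where
  "mat_poly_eval f A =
     (\<Sum>m\<in>Poly_Mapping.keys f. Poly_Mapping.lookup f m * (\<Prod>(i, j)\<in>Poly_Mapping.keys m. (A $ i $ j) ^ Poly_Mapping.lookup m (i, j)))"

definition mat_polys_over :: "'a::field set \<Rightarrow> ('a, 'n::finite) mat_poly set" where
  "mat_polys_over K = {f. \<forall>m. Poly_Mapping.lookup f m \<in> K}"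

definition vanishing_ideal :: "('a::field ^ 'n::finite ^ 'n) set \<Rightarrow> ('a, 'n) mat_poly set" where
  "vanishing_ideal V = {f. \<forall>A\<in>V. mat_poly_eval f A = 0}"

definition zariski :: "('a::field ^ 'n::finite ^ 'n) topology" where
  "zariski = topology_generated_by (range (\<lambda>f. {A. mat_poly_eval f A \<noteq> 0}))"

definition GL :: "('a::field ^ 'n::finite ^ 'n) monoid" where
  "GL = \<lparr>carrier = {A. invertible A}, mult = (**), one = mat 1\<rparr>"

text \<open>
  \<open>V\<close> is defined over \<open>K\<close> if its ideal, over the algebraic closure, is generated by polynomials with
  coefficients in \<open>K\<close>; over an imperfect field this is stronger than being the zero set of such
  polynomials.
\<close>

definition defined_over :: "'a::field set \<Rightarrow> ('a ^ 'n::finite ^ 'n) set \<Rightarrow> bool" where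
  "defined_over K V \<longleftrightarrow>
     Idl\<^bsub>ring_of_type_algebra\<^esub> (vanishing_ideal V \<inter> mat_polys_over K) = vanishing_ideal V"

definition closed_subgroup :: "('a::field ^ 'n::finite ^ 'n) set \<Rightarrow> bool" where
  "closed_subgroup H \<longleftrightarrow>
     subgroup H GL \<and> closedin (subtopology zariski (carrier GL)) H"

definition linear_algebraic_group :: "'a::field set \<Rightarrow> ('a ^ 'n::finite ^ 'n) set \<Rightarrow> bool" where
  "linear_algebraic_group K H \<longleftrightarrow> closed_subgroup H \<and> defined_over K H"

text \<open>Connected with trivial radical; this is a property of the group over the algebraic closure.\<close>

definition semisimple_group :: "'a::field set \<Rightarrow> ('a ^ 'n::finite ^ 'n) set \<Rightarrow> bool" where
  "semisimple_group K G \<longleftrightarrow>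
     linear_algebraic_group K G \<and> connectedin zariski G \<and>
     (\<forall>R. closed_subgroup R \<and> R \<lhd> (GL\<lparr>carrier := G\<rparr>) \<and> connectedin zariski R \<and>
          solvable (GL\<lparr>carrier := R\<rparr>) \<longrightarrow> R = {\<one>\<^bsub>GL\<^esub>})"

definition central_subgroup ::
    "'a::field set \<Rightarrow> ('a ^ 'n::finite ^ 'n) set \<Rightarrow> ('a ^ 'n ^ 'n) set \<Rightarrow> bool" where
  "central_subgroup K Z G \<longleftrightarrow>
     linear_algebraic_group K Z \<and> Z \<subseteq> G \<and> (\<forall>z\<in>Z. \<forall>g\<in>G. z ** g = g ** z)"

definition rational_points ::
    "'a set \<Rightarrow> ('a::field ^ 'n::finite ^ 'n) set \<Rightarrow> ('a ^ 'n ^ 'n) set" where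
  "rational_points \<Omega> H = {A\<in>H. \<forall>i j. A $ i $ j \<in> \<Omega>}"

section \<open>Galois groups with the Krull topology\<close>

text \<open>
  For every intermediate field \<open>F\<close> the cohomology of \<open>F\<close> is computed with the one fixed separable
  closure \<open>\<Omega>\<close> of \<open>K\<close>.  Automorphisms of \<open>\<Omega>\<close> are extensional functions on \<open>\<Omega>\<close>.
\<close>

definition Gal :: "'a::field set \<Rightarrow> 'a set \<Rightarrow> ('a \<Rightarrow> 'a) set" where
  "Gal \<Omega> F = {\<sigma>\<in>Bij \<Omega>. (\<forall>x\<in>\<Omega>. \<forall>y\<in>\<Omega>. \<sigma> (x + y) = \<sigma> x + \<sigma> y \<and> \<sigma> (x * y) = \<sigma> x * \<sigma> y) \<and>
                        (\<forall>x\<in>F. \<sigma> x = x)}"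

definition Gal_group :: "'a::field set \<Rightarrow> 'a set \<Rightarrow> ('a \<Rightarrow> 'a) monoid" where
  "Gal_group \<Omega> F = (BijGroup \<Omega>)\<lparr>carrier := Gal \<Omega> F\<rparr>"

definition krull_topology :: "'a::field set \<Rightarrow> 'a set \<Rightarrow> ('a \<Rightarrow> 'a) topology" where
  "krull_topology \<Omega> F = topology_generated_by
     {\<sigma> <#\<^bsub>Gal_group \<Omega> F\<^esub> Gal \<Omega> E | \<sigma> E.
        \<sigma> \<in> Gal \<Omega> F \<and> subfield E FR \<and> F \<subseteq> E \<and> E \<subseteq> \<Omega> \<and> ring.finite_dimension FR F E}"

section \<open>First Galois cohomology\<close>

definition cocycles ::
    "'a::field set \<Rightarrow> 'a set \<Rightarrow> ('a ^ 'n::finite ^ 'n) set \<Rightarrow> (('a \<Rightarrow> 'a) \<Rightarrow> 'a ^ 'n ^ 'n) set" where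
  "cocycles \<Omega> F H =
     {f \<in> Gal \<Omega> F \<rightarrow>\<^sub>E rational_points \<Omega> H.
        continuous_map (krull_topology \<Omega> F) (discrete_topology (rational_points \<Omega> H)) f \<and>
        (\<forall>\<sigma>\<in>Gal \<Omega> F. \<forall>\<tau>\<in>Gal \<Omega> F.
           f (\<sigma> \<otimes>\<^bsub>Gal_group \<Omega> F\<^esub> \<tau>) = f \<sigma> ** map_matrix \<sigma> (f \<tau>))}"

definition cohomologous ::
    "'a::field set \<Rightarrow> 'a set \<Rightarrow> ('a ^ 'n::finite ^ 'n) set \<Rightarrow>
     ((('a \<Rightarrow> 'a) \<Rightarrow> 'a ^ 'n ^ 'n) \<times> (('a \<Rightarrow> 'a) \<Rightarrow> 'a ^ 'n ^ 'n)) set" where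
  "cohomologous \<Omega> F H =
     {(f, g) \<in> cocycles \<Omega> F H \<times> cocycles \<Omega> F H.
        \<exists>c\<in>rational_points \<Omega> H. \<forall>\<sigma>\<in>Gal \<Omega> F. g \<sigma> = matrix_inv c ** f \<sigma> ** map_matrix \<sigma> c}"

definition H1 ::
    "'a::field set \<Rightarrow> 'a set \<Rightarrow> ('a ^ 'n::finite ^ 'n) set \<Rightarrow> (('a \<Rightarrow> 'a) \<Rightarrow> 'a ^ 'n ^ 'n) set set" where
  "H1 \<Omega> F H = cocycles \<Omega> F H // cohomologous \<Omega> F H"

definition H1_trivial ::
    "'a::field set \<Rightarrow> 'a set \<Rightarrow> ('a ^ 'n::finite ^ 'n) set \<Rightarrow> (('a \<Rightarrow> 'a) \<Rightarrow> 'a ^ 'n ^ 'n) set" where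
  "H1_trivial \<Omega> F H = cohomologous \<Omega> F H `` {\<lambda>\<sigma>\<in>Gal \<Omega> F. mat 1}"

text \<open>
  The map \<open>H1 \<Omega> F Z \<rightarrow> H1 \<Omega> F S\<close> induced by an inclusion \<open>Z \<subseteq> S\<close>: a class in \<open>H1 \<Omega> F Z\<close> goes to the
  class in \<open>H1 \<Omega> F S\<close> of any of its cocycles.
\<close>

definition H1_incl ::
    "'a::field set \<Rightarrow> 'a set \<Rightarrow> ('a ^ 'n::finite ^ 'n) set \<Rightarrow>
     (('a \<Rightarrow> 'a) \<Rightarrow> 'a ^ 'n ^ 'n) set \<Rightarrow> (('a \<Rightarrow> 'a) \<Rightarrow> 'a ^ 'n ^ 'n) set" where
  "H1_incl \<Omega> F S C = cohomologous \<Omega> F S `` C"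

definition H1_kernel ::
    "'a::field set \<Rightarrow> 'a set \<Rightarrow> ('a ^ 'n::finite ^ 'n) set \<Rightarrow> ('a ^ 'n ^ 'n) set \<Rightarrow>
     (('a \<Rightarrow> 'a) \<Rightarrow> 'a ^ 'n ^ 'n) set set" where
  "H1_kernel \<Omega> F Z S = {C \<in> H1 \<Omega> F Z. H1_incl \<Omega> F S C = H1_trivial \<Omega> F S}"

text \<open>
  Corestriction, by its usual formula on cochains: choose a representative \<open>rep c\<close> of each right
  coset \<open>c\<close> of \<open>\<Gamma>\<^sub>L = Gal \<Omega> L\<close> in \<open>\<Gamma>\<^sub>K = Gal \<Omega> K\<close>; then (written multiplicatively)
  \<open>(cor f) \<sigma>\<close> is the product over all cosets \<open>c\<close> of
  \<open>(rep c)\<inverse> (f (rep c \<cdot> \<sigma> \<cdot> (rep (c \<sigma>))\<inverse>))\<close>.  Cochains depend on the choice of \<open>rep\<close>,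
  cohomology classes do not.  The product is the one of the commutative group \<open>Z(\<Omega>)\<close>.
\<close>

definition cores_cochain ::
    "'a::field set \<Rightarrow> 'a set \<Rightarrow> 'a set \<Rightarrow> ('a ^ 'n::finite ^ 'n) set \<Rightarrow>
     (('a \<Rightarrow> 'a) \<Rightarrow> 'a ^ 'n ^ 'n) \<Rightarrow> (('a \<Rightarrow> 'a) \<Rightarrow> 'a ^ 'n ^ 'n)" where
  "cores_cochain \<Omega> L K Z f =
     (\<lambda>\<sigma>\<in>Gal \<Omega> K.
        let \<Gamma> = Gal_group \<Omega> K; rep = (\<lambda>c. SOME t. t \<in> c)
        in \<Otimes>\<^bsub>GL\<lparr>carrier := rational_points \<Omega> Z\<rparr>\<^esub>c\<in>rcosets\<^bsub>\<Gamma>\<^esub> (Gal \<Omega> L).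
             map_matrix (inv\<^bsub>\<Gamma>\<^esub> (rep c))
               (f (rep c \<otimes>\<^bsub>\<Gamma>\<^esub> \<sigma> \<otimes>\<^bsub>\<Gamma>\<^esub> inv\<^bsub>\<Gamma>\<^esub> (rep (c #>\<^bsub>\<Gamma>\<^esub> \<sigma>)))))"

definition cores ::
    "'a::field set \<Rightarrow> 'a set \<Rightarrow> 'a set \<Rightarrow> ('a ^ 'n::finite ^ 'n) set \<Rightarrow>
     (('a \<Rightarrow> 'a) \<Rightarrow> 'a ^ 'n ^ 'n) set \<Rightarrow> (('a \<Rightarrow> 'a) \<Rightarrow> 'a ^ 'n ^ 'n) set" where
  "cores \<Omega> L K Z C = cohomologous \<Omega> K Z `` (cores_cochain \<Omega> L K Z ` C)"

definition H1_norm_principle ::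
    "'a::field set \<Rightarrow> 'a set \<Rightarrow> 'a set \<Rightarrow> ('a ^ 'n::finite ^ 'n) set \<Rightarrow> ('a ^ 'n ^ 'n) set \<Rightarrow> bool" where
  "H1_norm_principle \<Omega> L K Z S \<longleftrightarrow>
     cores \<Omega> L K Z ` H1_kernel \<Omega> L Z S \<subseteq> H1_kernel \<Omega> K Z S"

end

theory Submission
  imports Defs
begin

text \<open>
  Let \<open>f\<close> be a cocycle over \<open>L\<close> with values in \<open>Z\<^sub>1\<close> whose class becomes trivial in \<open>G\<close>.  Its class for \<open>Z\<^sub>2\<close>
  becomes trivial in \<open>G\<close> as well, so by hypothesis the corestriction of that class becomes trivial in
  \<open>G\<close>.  Corestriction commutes with the inclusion \<open>Z\<^sub>1 \<subseteq> Z\<^sub>2\<close>: the defining product has the same factors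
  in both groups (\<open>cores_cochain_change_target\<close>).  Hence the corestrictions for \<open>Z\<^sub>1\<close> and for \<open>Z\<^sub>2\<close> have
  the same image in the cohomology of \<open>G\<close> over \<open>K\<close>, and it is trivial.

  The corestriction is given by a formula on cochains, so this argument also has to show that the
  formula turns \<open>f\<close> into a continuous cocycle for \<open>Z\<^sub>1\<close> whose class depends on that of \<open>f\<close> only.  The
  cocycle property is extracted from the hypothesis.  The norm principle for \<open>Z\<^sub>2\<close> contains the
  assertion that the corestriction of the class of \<open>f\<close> is an element of \<open>H1 \<Omega> K Z\<^sub>2\<close>; being nonempty,
  it contains the corestriction of some \<open>g\<close> cohomologous to \<open>f\<close>, and this corestriction is a cocycle.
  If \<open>f\<close> and \<open>g\<close> differ by the coboundary of \<open>b\<close>, their corestrictions differ by the coboundary of the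
  norm-like product \<open>N\<close> of the conjugates of \<open>b\<close> over the cosets of \<open>Gal \<Omega> L\<close>
  (\<open>transfer_coboundary\<close>).  Changing a continuous cocycle by a coboundary gives a continuous cocycle
  (\<open>twist_cocycle\<close>), because every element of \<open>\<Omega>\<close> has an open stabiliser.  So the corestriction of
  \<open>f\<close> is a cocycle for \<open>Z\<^sub>2\<close>, and its values lie in \<open>Z\<^sub>1(\<Omega>)\<close>.  The same computation of coboundaries shows
  that its class is well defined (\<open>cores_class\<close>).

  Two facts of a different kind are used throughout.  The field \<open>L\<close> lies in \<open>\<Omega>\<close>, which makes
  \<open>Gal \<Omega> L\<close> a subgroup of \<open>Gal \<Omega> K\<close>.  And for an algebraic group \<open>H\<close> over \<open>K\<close> the set \<open>H(\<Omega>)\<close> is a group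
  on which \<open>Gal \<Omega> K\<close> acts entrywise: inverses are rational by Cramer's rule, and the action preserves
  \<open>H\<close> because the ideal of \<open>H\<close> is generated by polynomials over \<open>K\<close>.
\<close>

section \<open>Subfields and the separable closure\<close>

lemma FR_simps:
  "carrier FR = UNIV" "x \<oplus>\<^bsub>FR\<^esub> y = x + y" "x \<otimes>\<^bsub>FR\<^esub> y = x * y" "\<zero>\<^bsub>FR\<^esub> = 0" "\<one>\<^bsub>FR\<^esub> = 1"
  by (simp_all add: ring_of_type_algebra_def)

lemma a_inv_FR: "\<ominus>\<^bsub>FR\<^esub> x = - (x :: 'a::field)"
proof -
  interpret field "FR :: 'a ring" by (rule field_from_type_algebra)
  show ?thesis
    by (rule minus_equality) (simp_all add: FR_simps)
qed

lemma m_inv_FR: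
  assumes "x \<noteq> (0 :: 'a::field)"
  shows "inv\<^bsub>FR\<^esub> x = inverse x"
proof -
  interpret field "FR :: 'a ring" by (rule field_from_type_algebra)
  show ?thesis
    using assms by (intro comm_inv_char) (simp_all add: FR_simps)
qed

lemma subfield_FRD:
  assumes "subfield F (FR :: 'a::field ring)"
  shows "0 \<in> F" "1 \<in> F" "x \<in> F \<Longrightarrow> y \<in> F \<Longrightarrow> x + y \<in> F" "x \<in> F \<Longrightarrow> y \<in> F \<Longrightarrow> x * y \<in> F"
    "x \<in> F \<Longrightarrow> - x \<in> F" "x \<in> F \<Longrightarrow> inverse x \<in> F"
proof -
  interpret field "FR :: 'a ring" by (rule field_from_type_algebra)
  note sr = subringE[OF subfieldE(1)[OF assms], unfolded FR_simps a_inv_FR]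
  show "0 \<in> F" "1 \<in> F" "x \<in> F \<Longrightarrow> y \<in> F \<Longrightarrow> x + y \<in> F" "x \<in> F \<Longrightarrow> y \<in> F \<Longrightarrow> x * y \<in> F"
    "x \<in> F \<Longrightarrow> - x \<in> F"
    using sr by auto
  show "inverse x \<in> F" if "x \<in> F"
  proof (cases "x = 0")
    case False
    then show ?thesis
      using subfield_m_inv(1)[OF assms, of x] that by (simp add: FR_simps m_inv_FR)
  qed (use sr in simp)
qed

lemma subfield_FR_sum:
  assumes "subfield F (FR :: 'a::field ring)" "\<And>i. i \<in> I \<Longrightarrow> f i \<in> F"
  shows "sum f I \<in> F"
  using assms(2) by (induction I rule: infinite_finite_induct) (simp_all add: subfield_FRD[OF assms(1)])

lemma subfield_FR_prod:
  assumes "subfield F (FR :: 'a::field ring)" "\<And>i. i \<in> I \<Longrightarrow> f i \<in> F"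
  shows "prod f I \<in> F"
  using assms(2) by (induction I rule: infinite_finite_induct) (simp_all add: subfield_FRD[OF assms(1)])

lemma subfield_FR_power:
  assumes "subfield F (FR :: 'a::field ring)" "x \<in> F"
  shows "x ^ n \<in> F"
  by (induction n) (simp_all add: subfield_FRD[OF assms(1)] assms(2))

text \<open>
  Division with remainder only divides by the leading coefficient of \<open>q\<close>, so the remainder has
  coefficients in the same field.
\<close>

lemma polys_over_division:
  fixes p q :: "'a::field poly"
  assumes F: "subfield F (FR :: 'a ring)" and q: "q \<in> polys_over F" "q \<noteq> 0" and p: "p \<in> polys_over F"
  shows "\<exists>s r. r \<in> polys_over F \<and> p = q * s + r \<and>
    (r = 0 \<or> Polynomial.degree r < Polynomial.degree q)"
  using p
proof (induction "Polynomial.degree p" arbitrary: p rule: less_induct)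
  case less
  show ?case
  proof (cases "p = 0 \<or> Polynomial.degree p < Polynomial.degree q")
    case True
    then show ?thesis
      using less.prems by (intro exI[of _ 0] exI[of _ p]) auto
  next
    case False
    define m where "m = Polynomial.monom (Polynomial.lead_coeff p / Polynomial.lead_coeff q)
      (Polynomial.degree p - Polynomial.degree q)"
    define p' where "p' = p - q * m"
    have p': "p' \<in> polys_over F"
      unfolding p'_def m_def polys_over_def
      using less.prems q(1)
      by (auto simp: polys_over_def mult.commute[of q] coeff_monom_mult divide_inverse diff_conv_add_uminus
          simp del: add_uminus_conv_diff intro!: subfield_FRD[OF F])
    have deg: "Polynomial.degree (q * m) = Polynomial.degree p"
      using False q by (simp add: m_def degree_mult_eq degree_monom_eq)
    have lc: "Polynomial.lead_coeff (q * m) = Polynomial.lead_coeff p"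
      using False q unfolding lead_coeff_mult by (simp add: m_def degree_monom_eq)
    have "\<exists>s r. r \<in> polys_over F \<and> p' = q * s + r \<and>
        (r = 0 \<or> Polynomial.degree r < Polynomial.degree q)"
    proof (cases "p' = 0")
      case True
      then show ?thesis
        by (intro exI[of _ 0]) (auto simp: polys_over_def subfield_FRD[OF F])
    next
      case nz: False
      have "Polynomial.degree p' < Polynomial.degree p"
        using deg lc nz unfolding p'_def
        by (metis coeff_diff degree_diff_le eq_iff_diff_eq_0 leading_coeff_neq_0 order_le_imp_less_or_eq order_refl)
      then show ?thesis
        using less.hyps p' by blast
    qed
    then obtain s r where "r \<in> polys_over F" "p' = q * s + r"
        "r = 0 \<or> Polynomial.degree r < Polynomial.degree q" by blast
    then show ?thesis
      by (intro exI[of _ "s + m"] exI[of _ r]) (auto simp: p'_def algebra_simps)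
  qed
qed

lemma rsquarefree_dvd:
  fixes p q :: "'a::field poly"
  assumes "rsquarefree p" "q dvd p"
  shows "rsquarefree q"
proof -
  have p: "p \<noteq> 0" "\<And>a. Polynomial.order a p = 0 \<or> Polynomial.order a p = 1"
    using assms(1) by (auto simp: rsquarefree_def)
  have "Polynomial.order a q \<le> Polynomial.order a p" for a
    using dvd_imp_order_le[OF p(1) assms(2)] .
  then show ?thesis
    using p assms(2) unfolding rsquarefree_def
    by (metis One_nat_def dvd_0_left le_0_eq le_SucE)
qed

text \<open>
  The minimal polynomial over the larger field divides the one over the smaller field, and a divisor
  of a polynomial with simple roots has simple roots.
\<close>

lemma separable_over_mono:
  fixes x :: "'a::field"
  assumes F: "subfield F (FR :: 'a ring)" and "K \<subseteq> F" and sep: "separable_over K x"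
  shows "separable_over F x"
proof -
  obtain p where p: "is_minpoly K x p" "rsquarefree p"
    using sep by (auto simp: separable_over_def)
  have pF: "p \<in> polys_over F" and p0: "poly p x = 0" "p \<noteq> 0"
    using p \<open>K \<subseteq> F\<close> by (auto simp: is_minpoly_def polys_over_def)
  define P where "P q \<longleftrightarrow> q \<in> polys_over F \<and> q \<noteq> 0 \<and> poly q x = 0" for q
  have "P p" using pF p0 by (simp add: P_def)
  define q where "q = arg_min Polynomial.degree P"
  have q: "P q" and q_min: "\<And>r. P r \<Longrightarrow> Polynomial.degree q \<le> Polynomial.degree r"
    unfolding q_def using arg_min_nat_lemma[of P p Polynomial.degree, OF \<open>P p\<close>] by auto
  define q' where "q' = Polynomial.smult (inverse (Polynomial.lead_coeff q)) q"
  have q': "is_minpoly F x q'"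
    using q q_min unfolding is_minpoly_def q'_def P_def
    by (auto simp: polys_over_def subfield_FRD[OF F])
  have "q dvd p"
  proof -
    obtain s r where sr: "r \<in> polys_over F" "p = q * s + r"
      "r = 0 \<or> Polynomial.degree r < Polynomial.degree q"
      using polys_over_division[OF F _ _ pF, of q] q by (auto simp: P_def)
    have "poly r x = 0"
      using sr(2) p0 q by (simp add: P_def)
    then have "r = 0"
      using sr q_min[of r] unfolding P_def by (metis leD)
    then show ?thesis using sr(2) by simp
  qed
  then have "q' dvd p"
    using q by (simp add: q'_def P_def smult_dvd_iff)
  then show ?thesis
    using q' rsquarefree_dvd[OF p(2)] by (auto simp: separable_over_def)
qed

lemma separable_extension_le_separable_closure:
  fixes K L \<Omega> :: "'a::field set"
  assumes "is_separable_closure K \<Omega>" "finite_separable_extension K L"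
  shows "L \<subseteq> \<Omega>"
  using assms separable_over_mono[of \<Omega> K]
  by (auto simp: is_separable_closure_def finite_separable_extension_def)

section \<open>Galois groups\<close>

lemma Gal_mono: "F \<subseteq> E \<Longrightarrow> Gal \<Omega> E \<subseteq> Gal \<Omega> F"
  by (auto simp: Gal_def)

lemma GalD:
  assumes "\<sigma> \<in> Gal \<Omega> F"
  shows "\<sigma> \<in> Bij \<Omega>" "x \<in> \<Omega> \<Longrightarrow> \<sigma> x \<in> \<Omega>"
    "x \<in> \<Omega> \<Longrightarrow> y \<in> \<Omega> \<Longrightarrow> \<sigma> (x + y) = \<sigma> x + \<sigma> y"
    "x \<in> \<Omega> \<Longrightarrow> y \<in> \<Omega> \<Longrightarrow> \<sigma> (x * y) = \<sigma> x * \<sigma> y" "x \<in> F \<Longrightarrow> \<sigma> x = x"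
  using assms Bij_imp_funcset[of \<sigma> \<Omega>] by (auto simp: Gal_def)

lemma subgroup_Gal:
  fixes \<Omega> F :: "'a::field set"
  assumes \<Omega>: "subfield \<Omega> (FR :: 'a ring)" and F: "F \<subseteq> \<Omega>"
  shows "subgroup (Gal \<Omega> F) (BijGroup \<Omega>)"
proof -
  interpret B: group "BijGroup \<Omega>" by (rule group_BijGroup)
  show ?thesis
  proof (rule B.subgroupI)
    show "Gal \<Omega> F \<subseteq> carrier (BijGroup \<Omega>)"
      by (auto simp: Gal_def BijGroup_def)
    have "(\<lambda>x\<in>\<Omega>. x) \<in> Gal \<Omega> F"
      using F id_Bij[of \<Omega>] by (auto simp: Gal_def subfield_FRD[OF \<Omega>])
    then show "Gal \<Omega> F \<noteq> {}" by blast
  next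
    fix \<sigma> assume s: "\<sigma> \<in> Gal \<Omega> F"
    have "inv_into \<Omega> \<sigma> (x + y) = inv_into \<Omega> \<sigma> x + inv_into \<Omega> \<sigma> y" if "x \<in> \<Omega>" "y \<in> \<Omega>" for x y
      by (rule Bij_inv_into_lemma[where g = "(+)"])
        (use that GalD[OF s] in \<open>auto simp: subfield_FRD[OF \<Omega>]\<close>)
    moreover have "inv_into \<Omega> \<sigma> (x * y) = inv_into \<Omega> \<sigma> x * inv_into \<Omega> \<sigma> y"
      if "x \<in> \<Omega>" "y \<in> \<Omega>" for x y
      by (rule Bij_inv_into_lemma[where g = "(*)"])
        (use that GalD[OF s] in \<open>auto simp: subfield_FRD[OF \<Omega>]\<close>)
    moreover have "inv_into \<Omega> \<sigma> x = x" if "x \<in> F" for x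
      using GalD[OF s] F that by (intro inv_into_f_eq) (auto simp: Bij_def bij_betw_def)
    ultimately show "inv\<^bsub>BijGroup \<Omega>\<^esub> \<sigma> \<in> Gal \<Omega> F"
      using restrict_inv_into_Bij[OF GalD(1)[OF s]] F
      by (auto simp: inv_BijGroup[OF GalD(1)[OF s]] Gal_def subfield_FRD[OF \<Omega>])
  next
    fix \<sigma> \<tau> assume s: "\<sigma> \<in> Gal \<Omega> F" and t: "\<tau> \<in> Gal \<Omega> F"
    then show "\<sigma> \<otimes>\<^bsub>BijGroup \<Omega>\<^esub> \<tau> \<in> Gal \<Omega> F"
      using F compose_Bij[of \<sigma> \<Omega> \<tau>] GalD[OF s] GalD[OF t]
      by (auto simp: BijGroup_def Gal_def compose_eq subfield_FRD[OF \<Omega>])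
  qed
qed

lemma Gal_group_simps [simp]:
  "carrier (Gal_group \<Omega> F) = Gal \<Omega> F"
  by (simp add: Gal_group_def)

lemma Gal_group_mult:
  assumes "\<sigma> \<in> Gal \<Omega> F" "\<tau> \<in> Gal \<Omega> F" "x \<in> \<Omega>"
  shows "(\<sigma> \<otimes>\<^bsub>Gal_group \<Omega> F\<^esub> \<tau>) x = \<sigma> (\<tau> x)"
  using assms GalD(1)[of _ \<Omega> F] by (simp add: Gal_group_def BijGroup_def compose_eq)

lemma group_Gal_group:
  fixes \<Omega> F :: "'a::field set"
  assumes "subfield \<Omega> (FR :: 'a ring)" "F \<subseteq> \<Omega>"
  shows "group (Gal_group \<Omega> F)"
  unfolding Gal_group_def
  using group.subgroup_imp_group[OF group_BijGroup subgroup_Gal[OF assms]] .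

lemma subgroup_Gal_Gal:
  fixes \<Omega> F E :: "'a::field set"
  assumes \<Omega>: "subfield \<Omega> (FR :: 'a ring)" and "F \<subseteq> E" "E \<subseteq> \<Omega>"
  shows "subgroup (Gal \<Omega> E) (Gal_group \<Omega> F)"
  unfolding Gal_group_def
  using assms Gal_mono[OF \<open>F \<subseteq> E\<close>]
  by (intro group.subgroup_incl[OF group_BijGroup] subgroup_Gal) auto

text \<open>
  Every \<open>x\<close> is algebraic over \<open>K\<close>, so \<open>K(x)\<close> is one of the finite extensions that define the Krull
  topology; a whole coset of \<open>Gal \<Omega> (K(x))\<close> takes the same value at \<open>x\<close>.
\<close>

lemma openin_krull_agree:
  fixes K \<Omega> :: "'a::field set"
  assumes alg: "algebraic_closure (FR :: 'a ring) K" and \<Omega>: "subfield \<Omega> (FR :: 'a ring)" "K \<subseteq> \<Omega>"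
    and x: "x \<in> \<Omega>"
  shows "openin (krull_topology \<Omega> K) {\<sigma> \<in> Gal \<Omega> K. \<sigma> x = a}"
proof (subst openin_subopen, intro ballI)
  interpret algebraic_closure "FR :: 'a ring" K by (rule alg)
  interpret \<Gamma>: group "Gal_group \<Omega> K" by (rule group_Gal_group[OF \<Omega>])
  have K: "subfield K FR" by (rule subfield_axioms)
  define E where "E = simple_extension K x"
  have algx: "(algebraic over K) x"
    using algebraic_extension by (simp add: FR_simps)
  have E: "subfield E FR" "K \<subseteq> E" "finite_dimension K E" "x \<in> E" "E \<subseteq> \<Omega>"
    using simple_extension_is_subfield[OF K, of x] finite_dimension_simple_extension[OF K, of x] algx
      simple_extension_incl[OF subfieldE(3)[OF K], of x] simple_extension_mem[OF subfieldE(1)[OF K], of x]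
      simple_extension_subring_incl[OF subfieldE(1)[OF \<Omega>(1)] \<Omega>(2) x]
    by (auto simp: E_def FR_simps)
  fix \<sigma> assume "\<sigma> \<in> {\<sigma> \<in> Gal \<Omega> K. \<sigma> x = a}"
  then have s: "\<sigma> \<in> Gal \<Omega> K" "\<sigma> x = a" by auto
  have sub: "Gal \<Omega> E \<subseteq> Gal \<Omega> K" by (rule Gal_mono[OF E(2)])
  have EE: "subgroup (Gal \<Omega> E) (Gal_group \<Omega> K)"
    by (rule subgroup_Gal_Gal[OF \<Omega>(1) E(2,5)])
  show "\<exists>T. openin (krull_topology \<Omega> K) T \<and> \<sigma> \<in> T \<and> T \<subseteq> {\<sigma> \<in> Gal \<Omega> K. \<sigma> x = a}"
  proof (intro exI conjI)
    show "openin (krull_topology \<Omega> K) (\<sigma> <#\<^bsub>Gal_group \<Omega> K\<^esub> Gal \<Omega> E)"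
      unfolding krull_topology_def using s E by (intro topology_generated_by_Basis) blast
    show "\<sigma> \<in> \<sigma> <#\<^bsub>Gal_group \<Omega> K\<^esub> Gal \<Omega> E"
      using \<Gamma>.lcos_self[OF _ EE, of \<sigma>] s by simp
    show "\<sigma> <#\<^bsub>Gal_group \<Omega> K\<^esub> Gal \<Omega> E \<subseteq> {\<sigma> \<in> Gal \<Omega> K. \<sigma> x = a}"
    proof
      fix \<rho> assume "\<rho> \<in> \<sigma> <#\<^bsub>Gal_group \<Omega> K\<^esub> Gal \<Omega> E"
      then obtain \<tau> where t: "\<tau> \<in> Gal \<Omega> E" "\<rho> = \<sigma> \<otimes>\<^bsub>Gal_group \<Omega> K\<^esub> \<tau>"
        by (auto simp: l_coset_def)
      have tK: "\<tau> \<in> Gal \<Omega> K" using t sub by blast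
      have "\<rho> x = \<sigma> (\<tau> x)"
        using Gal_group_mult[OF s(1) tK x] t(2) by simp
      also have "\<tau> x = x" using GalD(5)[OF t(1) E(4)] .
      finally show "\<rho> \<in> {\<sigma> \<in> Gal \<Omega> K. \<sigma> x = a}"
        using \<Gamma>.m_closed[of \<sigma> \<tau>] s tK t by simp
    qed
  qed
qed

lemma topspace_krull_topology:
  fixes K \<Omega> :: "'a::field set"
  assumes "subfield \<Omega> (FR :: 'a ring)" "K \<subseteq> \<Omega>"
  shows "topspace (krull_topology \<Omega> K) \<subseteq> Gal \<Omega> K"
proof -
  interpret \<Gamma>: group "Gal_group \<Omega> K" by (rule group_Gal_group[OF assms])
  have "\<sigma> <#\<^bsub>Gal_group \<Omega> K\<^esub> Gal \<Omega> E \<subseteq> Gal \<Omega> K" if "\<sigma> \<in> Gal \<Omega> K" "K \<subseteq> E" for \<sigma> E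
    using \<Gamma>.l_coset_subset_G[of "Gal \<Omega> E" \<sigma>] Gal_mono[OF that(2)] that(1) by simp
  then show ?thesis
    unfolding krull_topology_def topology_generated_by_topspace by blast
qed

section \<open>Vanishing ideals and closed subgroups\<close>

text \<open>
  The product ranges over all matrix entries, not only over the variables that occur in the monomial;
  the extra factors are zeroth powers.  With a fixed index set the value is visibly multiplicative in
  the monomial.
\<close>

definition mat_monomial :: "'a::field ^ 'n::finite ^ 'n \<Rightarrow> (('n \<times> 'n) \<Rightarrow>\<^sub>0 nat) \<Rightarrow> 'a" where
  "mat_monomial A m = (\<Prod>(i, j)\<in>UNIV. (A $ i $ j) ^ Poly_Mapping.lookup m (i, j))"

lemma mat_poly_eval_superset:
  fixes A :: "'a::field ^ 'n::finite ^ 'n"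
  assumes "finite S" "Poly_Mapping.keys f \<subseteq> S"
  shows "mat_poly_eval f A = (\<Sum>m\<in>S. Poly_Mapping.lookup f m * mat_monomial A m)"
proof -
  have mon: "(\<Prod>(i, j)\<in>Poly_Mapping.keys m. (A $ i $ j) ^ Poly_Mapping.lookup m (i, j)) = mat_monomial A m" for m
    unfolding mat_monomial_def
    by (rule prod.mono_neutral_left) (auto simp: in_keys_iff)
  show ?thesis
    unfolding mat_poly_eval_def mon
    by (rule sum.mono_neutral_left) (use assms in \<open>auto simp: in_keys_iff\<close>)
qed

lemma mat_monomial_add: "mat_monomial A (m + m') = mat_monomial A m * mat_monomial A m'"
  unfolding mat_monomial_def prod.distrib[symmetric]
  by (rule prod.cong) (auto simp: lookup_add power_add)

lemma mat_monomial_0: "mat_monomial A 0 = 1"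
  by (simp add: mat_monomial_def case_prod_beta)

lemma mat_poly_eval_single: "mat_poly_eval (Poly_Mapping.single m c) A = c * mat_monomial A m"
  using mat_poly_eval_superset[of "{m}" "Poly_Mapping.single m c" A] by simp

lemma mat_poly_eval_add: "mat_poly_eval (f + g) A = mat_poly_eval f A + mat_poly_eval g A"
  using mat_poly_eval_superset[of "Poly_Mapping.keys f \<union> Poly_Mapping.keys g" f A]
    mat_poly_eval_superset[of "Poly_Mapping.keys f \<union> Poly_Mapping.keys g" g A]
    mat_poly_eval_superset[of "Poly_Mapping.keys f \<union> Poly_Mapping.keys g" "f + g" A]
    keys_add[of f g]
  by (simp add: lookup_add distrib_right sum.distrib)

lemma mat_poly_eval_0: "mat_poly_eval 0 A = 0"
  by (simp add: mat_poly_eval_def)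

lemma mat_poly_eval_1: "mat_poly_eval 1 A = 1"
  by (simp add: mat_poly_eval_single mat_monomial_0 flip: single_one)

lemma poly_mapping_single_induct [case_names zero single add]:
  fixes f :: "'b \<Rightarrow>\<^sub>0 'c::monoid_add"
  assumes "P 0" "\<And>m c. P (Poly_Mapping.single m c)" "\<And>f g. P f \<Longrightarrow> P g \<Longrightarrow> P (f + g)"
  shows "P f"
proof (induction f rule: update_induct)
  case (update f a b)
  have "Poly_Mapping.update a b f = f + Poly_Mapping.single a b"
    using update(1)
    by (intro poly_mapping_eqI) (auto simp: lookup_add lookup_update lookup_single in_keys_iff when_def)
  then show ?case
    using assms(2,3) update by simp
qed (rule assms(1))

lemma mat_poly_eval_mult: "mat_poly_eval (f * g) A = mat_poly_eval f A * mat_poly_eval g A"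
proof (induction f rule: poly_mapping_single_induct)
  case (single m c)
  show ?case
    by (induction g rule: poly_mapping_single_induct)
      (simp_all add: mat_poly_eval_0 mat_poly_eval_add mat_poly_eval_single mult_single
        mat_monomial_add algebra_simps)
qed (simp_all add: mat_poly_eval_0 mat_poly_eval_add algebra_simps)

lemma mat_poly_eval_uminus: "mat_poly_eval (- f) A = - mat_poly_eval f A"
  using mat_poly_eval_add[of f "- f" A] by (simp add: mat_poly_eval_0 minus_unique)

text \<open>
  The topology is only given by a subbasis.  Since products of polynomials define the intersections
  of principal open sets, the subbasis is in fact a basis.
\<close>

lemma zariski_open_principal_nbhd:
  assumes "generate_topology_on (range (\<lambda>f. {A. mat_poly_eval f A \<noteq> 0})) U" "B \<in> U"
  shows "\<exists>f. mat_poly_eval f B \<noteq> 0 \<and> {A. mat_poly_eval f A \<noteq> 0} \<subseteq> U"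
  using assms
proof (induction rule: generate_topology_on.induct)
  case (Int U V)
  then obtain f g where "mat_poly_eval f B \<noteq> 0" "{A. mat_poly_eval f A \<noteq> 0} \<subseteq> U"
    "mat_poly_eval g B \<noteq> 0" "{A. mat_poly_eval g A \<noteq> 0} \<subseteq> V" by blast
  then show ?case
    by (intro exI[of _ "f * g"]) (auto simp: mat_poly_eval_mult)
next
  case (UN \<U>)
  then show ?case by (meson Union_iff Union_upper order_trans)
qed auto

text \<open>
  A closed subset of \<open>GL\<close> is cut out inside \<open>GL\<close> by its vanishing ideal: a point outside has a
  principal open neighbourhood that misses the set, and the polynomial defining this neighbourhood
  vanishes on the set but not at the point.
\<close>

lemma closed_subgroup_memI:
  fixes B :: "'a::field ^ 'n::finite ^ 'n"
  assumes H: "closed_subgroup H" and inv: "invertible B"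
    and van: "\<And>f. f \<in> vanishing_ideal H \<Longrightarrow> mat_poly_eval f B = 0"
  shows "B \<in> H"
proof (rule ccontr)
  assume "B \<notin> H"
  obtain T where T: "closedin zariski T" "H = T \<inter> carrier GL"
    using H by (auto simp: closed_subgroup_def closedin_subtopology)
  have top: "topspace zariski = (UNIV :: ('a ^ 'n ^ 'n) set)"
  proof -
    have "A \<in> (\<Union>f. {A. mat_poly_eval f A \<noteq> 0})" for A :: "'a ^ 'n ^ 'n"
      by (rule UN_I[of 1]) (simp_all add: mat_poly_eval_1)
    then show ?thesis
      unfolding zariski_def topology_generated_by_topspace by blast
  qed
  have "generate_topology_on (range (\<lambda>f. {A. mat_poly_eval f A \<noteq> 0})) (- T)"
    using T(1) by (simp add: closedin_def top Compl_eq_Diff_UNIV openin_topology_generated_by_iff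
        flip: zariski_def)
      (simp add: zariski_def openin_topology_generated_by_iff)
  moreover have "B \<in> - T"
    using \<open>B \<notin> H\<close> inv T(2) by (simp add: GL_def)
  ultimately obtain f where f: "mat_poly_eval f B \<noteq> 0" "{A. mat_poly_eval f A \<noteq> 0} \<subseteq> - T"
    using zariski_open_principal_nbhd by blast
  then have "f \<in> vanishing_ideal H"
    using T(2) by (auto simp: vanishing_ideal_def)
  then show False using van f(1) by blast
qed

text \<open>
  The polynomials that vanish at \<open>B\<close> form an ideal, so it suffices to test the generators of the
  vanishing ideal.
\<close>

lemma vanishing_ideal_le_if_defined_over:
  fixes B :: "'a::field ^ 'n::finite ^ 'n"
  assumes H: "defined_over K H"
    and gen: "\<And>f. f \<in> vanishing_ideal H \<Longrightarrow> f \<in> mat_polys_over K \<Longrightarrow> mat_poly_eval f B = 0"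
    and f: "f \<in> vanishing_ideal H"
  shows "mat_poly_eval f B = 0"
proof -
  let ?R = "ring_of_type_algebra :: ('a, 'n) mat_poly ring"
  interpret R: ring ?R by (rule ring_from_type_algebra)
  have R: "carrier ?R = UNIV" "x \<oplus>\<^bsub>?R\<^esub> y = x + y" "x \<otimes>\<^bsub>?R\<^esub> y = x * y" "\<zero>\<^bsub>?R\<^esub> = 0" for x y
    by (simp_all add: ring_of_type_algebra_def)
  have minus: "\<ominus>\<^bsub>?R\<^esub> x = - x" for x
    by (rule R.minus_equality) (simp_all add: R)
  have "ideal {f. mat_poly_eval f B = 0} ?R"
  proof (rule idealI[OF R.ring_axioms])
    show "subgroup {f. mat_poly_eval f B = 0} (add_monoid ?R)"
    proof (rule R.add.subgroupI)
      show "{f. mat_poly_eval f B = 0} \<noteq> {}" using mat_poly_eval_0 by blast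
    qed (simp_all add: R minus mat_poly_eval_add mat_poly_eval_uminus flip: a_inv_def)
  qed (simp_all add: R mat_poly_eval_mult)
  then have "Idl\<^bsub>?R\<^esub> (vanishing_ideal H \<inter> mat_polys_over K) \<subseteq> {f. mat_poly_eval f B = 0}"
    by (rule R.genideal_minimal) (use gen in auto)
  then show ?thesis
    using H f unfolding defined_over_def by blast
qed

section \<open>Rational points as Galois modules\<close>

lemma matrix_inv_mult:
  assumes "invertible A"
  shows "A ** matrix_inv A = mat 1" "matrix_inv A ** A = mat 1"
  using someI_ex[OF assms[unfolded invertible_def]] by (simp_all add: matrix_inv_def)

lemma group_GL: "group (GL :: ('a::field ^ 'n::finite ^ 'n) monoid)"
proof (rule groupI)
  show "\<exists>B\<in>carrier GL. B \<otimes>\<^bsub>GL\<^esub> A = \<one>\<^bsub>GL\<^esub>" if "A \<in> carrier GL" for A :: "'a ^ 'n ^ 'n"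
    using that by (auto simp: GL_def invertible_def)
  show "\<one>\<^bsub>GL\<^esub> \<in> carrier (GL :: ('a ^ 'n ^ 'n) monoid)"
    using matrix_mul_lid[of "mat 1 :: 'a ^ 'n ^ 'n"] by (auto simp: GL_def invertible_def)
qed (auto simp: GL_def invertible_mult matrix_mul_assoc)

lemma inv_GL:
  fixes A :: "'a::field ^ 'n::finite ^ 'n"
  assumes "A \<in> carrier GL"
  shows "inv\<^bsub>GL\<^esub> A = matrix_inv A"
proof -
  interpret group "GL :: ('a ^ 'n ^ 'n) monoid" by (rule group_GL)
  have "invertible A" using assms by (simp add: GL_def)
  then show ?thesis
    using assms matrix_inv_mult[of A] by (intro inv_equality) (auto simp: GL_def invertible_def)
qed

text \<open>
  By Cramer's rule the entries of the inverse are quotients of determinants with entries in \<open>\<Omega>\<close>.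
\<close>

lemma matrix_inv_entries:
  fixes A :: "'a::field ^ 'n::finite ^ 'n"
  assumes \<Omega>: "subfield \<Omega> (FR :: 'a ring)" and A: "\<And>i j. A $ i $ j \<in> \<Omega>" and inv: "invertible A"
  shows "matrix_inv A $ i $ j \<in> \<Omega>"
proof -
  have det: "det B \<in> \<Omega>" if "\<And>i j. B $ i $ j \<in> \<Omega>" for B :: "'a ^ 'n ^ 'n"
    unfolding det_def using that
    by (intro subfield_FR_sum[OF \<Omega>] subfield_FRD(4)[OF \<Omega>] subfield_FR_prod[OF \<Omega>])
      (auto simp: sign_def subfield_FRD[OF \<Omega>])
  have "A *v (matrix_inv A *v axis j 1) = axis j 1"
    by (simp add: matrix_vector_mul_assoc matrix_inv_mult[OF inv])
  then have "matrix_inv A *v axis j 1 =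
      (\<chi> k. det (\<chi> i l. if l = k then axis j 1 $ i else A $ i $ l) / det A)"
    using inv cramer[of A] by (simp add: invertible_det_nz)
  moreover have "(matrix_inv A *v axis j 1) $ i = matrix_inv A $ i $ j"
    by (simp add: matrix_vector_mult_def axis_def if_distrib cong: if_cong)
  ultimately have "matrix_inv A $ i $ j = det (\<chi> k l. if l = i then axis j 1 $ k else A $ k $ l) / det A"
    by simp
  also have "\<dots> \<in> \<Omega>"
    unfolding divide_inverse
    by (intro subfield_FRD(4,6)[OF \<Omega>] det) (auto simp: A axis_def subfield_FRD[OF \<Omega>])
  finally show ?thesis .
qed

locale galois_setting =
  fixes K \<Omega> :: "'a::field set"
  assumes alg_closure: "algebraic_closure (FR :: 'a ring) K"
    and sep_closure: "is_separable_closure K \<Omega>"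
begin

lemma subfield_K: "subfield K FR" and subfield_\<Omega>: "subfield \<Omega> FR" and K_le_\<Omega>: "K \<subseteq> \<Omega>"
  using sep_closure by (auto simp: is_separable_closure_def)

lemmas \<Omega>_closed = subfield_FRD[OF subfield_\<Omega>]

lemma Gal_0_1:
  assumes "\<sigma> \<in> Gal \<Omega> K"
  shows "\<sigma> 0 = 0" "\<sigma> 1 = 1"
  using GalD(5)[OF assms] subfield_FRD[OF subfield_K] by auto

lemma Gal_sum:
  assumes "\<sigma> \<in> Gal \<Omega> K" "\<And>i. i \<in> I \<Longrightarrow> f i \<in> \<Omega>"
  shows "\<sigma> (sum f I) = (\<Sum>i\<in>I. \<sigma> (f i))"
  using assms(2)
  by (induction I rule: infinite_finite_induct)
    (simp_all add: Gal_0_1[OF assms(1)] GalD(3)[OF assms(1)] subfield_FR_sum[OF subfield_\<Omega>])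

lemma Gal_prod:
  assumes "\<sigma> \<in> Gal \<Omega> K" "\<And>i. i \<in> I \<Longrightarrow> f i \<in> \<Omega>"
  shows "\<sigma> (prod f I) = (\<Prod>i\<in>I. \<sigma> (f i))"
  using assms(2)
  by (induction I rule: infinite_finite_induct)
    (simp_all add: Gal_0_1[OF assms(1)] GalD(4)[OF assms(1)] subfield_FR_prod[OF subfield_\<Omega>])

lemma Gal_power:
  assumes "\<sigma> \<in> Gal \<Omega> K" "x \<in> \<Omega>"
  shows "\<sigma> (x ^ n) = \<sigma> x ^ n"
  by (induction n) (simp_all add: Gal_0_1[OF assms(1)] GalD(4)[OF assms(1)] assms(2)
      subfield_FR_power[OF subfield_\<Omega>])

lemma map_matrix_mult:
  fixes A B :: "'a ^ 'n::finite ^ 'n"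
  assumes "\<sigma> \<in> Gal \<Omega> K" "\<And>i j. A $ i $ j \<in> \<Omega>" "\<And>i j. B $ i $ j \<in> \<Omega>"
  shows "map_matrix \<sigma> (A ** B) = map_matrix \<sigma> A ** map_matrix \<sigma> B"
  using assms
  by (simp add: vec_eq_iff matrix_matrix_mult_def Gal_sum[OF assms(1)] GalD(4)[OF assms(1)] \<Omega>_closed)

lemma map_matrix_one: "\<sigma> \<in> Gal \<Omega> K \<Longrightarrow> map_matrix \<sigma> (mat 1) = mat 1"
  by (simp add: vec_eq_iff mat_def Gal_0_1)

lemma mat_poly_eval_Gal:
  fixes A :: "'a ^ 'n::finite ^ 'n"
  assumes s: "\<sigma> \<in> Gal \<Omega> K" and f: "f \<in> mat_polys_over K" and A: "\<And>i j. A $ i $ j \<in> \<Omega>"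
  shows "mat_poly_eval f (map_matrix \<sigma> A) = \<sigma> (mat_poly_eval f A)"
proof -
  have fK: "Poly_Mapping.lookup f m \<in> K" for m
    using f by (simp add: mat_polys_over_def)
  have pw: "(A $ i $ j) ^ n \<in> \<Omega>" for i j n
    by (rule subfield_FR_power[OF subfield_\<Omega> A])
  have mon: "mat_monomial A m \<in> \<Omega>" for m
    unfolding mat_monomial_def by (rule subfield_FR_prod[OF subfield_\<Omega>]) (auto simp: pw)
  have "mat_monomial (map_matrix \<sigma> A) m = \<sigma> (mat_monomial A m)" for m
    unfolding mat_monomial_def
    by (subst Gal_prod[OF s]) (auto simp: pw Gal_power[OF s A] intro!: prod.cong)
  then show ?thesis
    using fK K_le_\<Omega> mon GalD(4,5)[OF s]
    by (auto simp: mat_poly_eval_superset[OF finite_keys order_refl] Gal_sum[OF s] \<Omega>_closed subset_iff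
        intro!: sum.cong)
qed

lemma rational_pointsD: "A \<in> rational_points \<Omega> H \<Longrightarrow> A $ i $ j \<in> \<Omega>" "A \<in> rational_points \<Omega> H \<Longrightarrow> A \<in> H"
  by (auto simp: rational_points_def)

lemma subgroup_rational_points:
  fixes H :: "('a ^ 'n::finite ^ 'n) set"
  assumes "linear_algebraic_group K H"
  shows "subgroup (rational_points \<Omega> H) GL"
proof -
  interpret GL: group "GL :: ('a ^ 'n ^ 'n) monoid" by (rule group_GL)
  have H: "subgroup H GL"
    using assms by (simp add: linear_algebraic_group_def closed_subgroup_def)
  show ?thesis
  proof (rule GL.subgroupI)
    show "rational_points \<Omega> H \<subseteq> carrier GL"
      using subgroup.subset[OF H] by (auto simp: rational_points_def)
    have "mat 1 \<in> rational_points \<Omega> H"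
      using subgroup.one_closed[OF H] by (auto simp: rational_points_def GL_def mat_def \<Omega>_closed)
    then show "rational_points \<Omega> H \<noteq> {}" by blast
  next
    fix A assume A: "A \<in> rational_points \<Omega> H"
    then have "A \<in> carrier GL" "A \<in> H"
      using subgroup.subset[OF H] by (auto simp: rational_points_def)
    then show "inv\<^bsub>GL\<^esub> A \<in> rational_points \<Omega> H"
      using A matrix_inv_entries[OF subfield_\<Omega>, of A] subgroup.m_inv_closed[OF H, of A]
      by (auto simp: rational_points_def inv_GL) (simp_all add: GL_def)
  next
    fix A B assume "A \<in> rational_points \<Omega> H" "B \<in> rational_points \<Omega> H"
    then show "A \<otimes>\<^bsub>GL\<^esub> B \<in> rational_points \<Omega> H"
      using subgroup.m_closed[OF H, of A B] subfield_FR_sum[OF subfield_\<Omega>]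
      by (auto simp: rational_points_def GL_def matrix_matrix_mult_def \<Omega>_closed intro!: subfield_FR_sum[OF subfield_\<Omega>])
  qed
qed

text \<open>
  A polynomial over \<open>K\<close> that vanishes at \<open>A\<close> also vanishes at its conjugates, and such polynomials
  generate the whole vanishing ideal of \<open>H\<close>.
\<close>

lemma Gal_rational_points:
  fixes H :: "('a ^ 'n::finite ^ 'n) set"
  assumes H: "linear_algebraic_group K H" and s: "\<sigma> \<in> Gal \<Omega> K" and A: "A \<in> rational_points \<Omega> H"
  shows "map_matrix \<sigma> A \<in> rational_points \<Omega> H"
proof -
  have Ar: "A $ i $ j \<in> \<Omega>" for i j by (rule rational_pointsD[OF A])
  have "A \<in> carrier GL"
    using A subgroup.subset[OF subgroup_rational_points[OF H]] by blast
  then have inv: "invertible A" by (simp add: GL_def)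
  have Ai: "matrix_inv A $ i $ j \<in> \<Omega>" for i j
    by (rule matrix_inv_entries[OF subfield_\<Omega> Ar inv])
  have "map_matrix \<sigma> A \<in> H"
  proof (rule closed_subgroup_memI)
    show "closed_subgroup H" using H by (simp add: linear_algebraic_group_def)
    show "invertible (map_matrix \<sigma> A)"
      unfolding invertible_def
    proof (intro exI conjI)
      show "map_matrix \<sigma> A ** map_matrix \<sigma> (matrix_inv A) = mat 1"
        unfolding map_matrix_mult[OF s Ar Ai, symmetric] matrix_inv_mult[OF inv] by (rule map_matrix_one[OF s])
      show "map_matrix \<sigma> (matrix_inv A) ** map_matrix \<sigma> A = mat 1"
        unfolding map_matrix_mult[OF s Ai Ar, symmetric] matrix_inv_mult[OF inv] by (rule map_matrix_one[OF s])
    qed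
    fix f :: "('a, 'n) mat_poly" assume f: "f \<in> vanishing_ideal H"
    show "mat_poly_eval f (map_matrix \<sigma> A) = 0"
    proof (rule vanishing_ideal_le_if_defined_over[OF _ _ f])
      show "defined_over K H" using H by (simp add: linear_algebraic_group_def)
      fix g :: "('a, 'n) mat_poly" assume g: "g \<in> vanishing_ideal H" "g \<in> mat_polys_over K"
      have "mat_poly_eval g A = 0"
        using g(1) rational_pointsD(2)[OF A] by (simp add: vanishing_ideal_def)
      then show "mat_poly_eval g (map_matrix \<sigma> A) = 0"
        by (simp add: mat_poly_eval_Gal[OF s g(2) Ar] Gal_0_1[OF s])
    qed
  qed
  then show ?thesis
    using Ar GalD(2)[OF s] by (simp add: rational_points_def)
qed

end

section \<open>The transfer of cochains\<close>

lemma (in comm_group) finprod_subgroup: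
  assumes H: "subgroup H G" and f: "f \<in> A \<rightarrow> H"
  shows "finprod (G\<lparr>carrier := H\<rparr>) f A = finprod G f A"
proof -
  interpret H: comm_group "G\<lparr>carrier := H\<rparr>"
    using subgroup.subset[OF H] m_comm
    by (intro group.group_comm_groupI subgroup.subgroup_is_group[OF H] is_group) (auto simp: subset_iff)
  have H_le: "H \<subseteq> carrier G" by (rule subgroup.subset[OF H])
  show ?thesis
    using f
  proof (induction A rule: infinite_finite_induct)
    case (insert a A)
    then show ?case
      using H_le by (subst H.finprod_insert, simp_all add: Pi_iff) (subst finprod_insert, auto)
  qed (simp_all add: finprod_infinite H.finprod_infinite)
qed

text \<open>
  The transfer is purely group theoretic, so it is treated for an arbitrary group \<open>\<Gamma>\<close> that acts on a
  commutative group \<open>M\<close>, with a subgroup \<open>\<Delta>\<close>.  Products over an infinite set of cosets are \<open>\<one>\<close> by the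
  convention for \<open>finprod\<close>, and the identities below hold under that convention too.
\<close>

locale coset_transfer =
  \<Gamma>: group \<Gamma> + M: comm_group M for \<Gamma> :: "('g, 'x) monoid_scheme" and M :: "('m, 'y) monoid_scheme" +
  fixes \<Delta> :: "'g set" and act :: "'g \<Rightarrow> 'm \<Rightarrow> 'm"
  assumes \<Delta>: "subgroup \<Delta> \<Gamma>"
    and act_closed: "\<lbrakk>s \<in> carrier \<Gamma>; a \<in> carrier M\<rbrakk> \<Longrightarrow> act s a \<in> carrier M"
    and act_mult: "\<lbrakk>s \<in> carrier \<Gamma>; a \<in> carrier M; b \<in> carrier M\<rbrakk> \<Longrightarrow>
      act s (a \<otimes>\<^bsub>M\<^esub> b) = act s a \<otimes>\<^bsub>M\<^esub> act s b"
    and act_act: "\<lbrakk>s \<in> carrier \<Gamma>; t \<in> carrier \<Gamma>; a \<in> carrier M\<rbrakk> \<Longrightarrow>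
      act (s \<otimes>\<^bsub>\<Gamma>\<^esub> t) a = act s (act t a)"
begin

definition rep :: "'g set \<Rightarrow> 'g" where
  "rep c = (SOME t. t \<in> c)"

text \<open>
  The element of \<open>\<Delta>\<close> by which right translation by \<open>s\<close> fails to preserve the chosen coset
  representatives.
\<close>

definition coset_factor :: "'g set \<Rightarrow> 'g \<Rightarrow> 'g" where
  "coset_factor c s = rep c \<otimes>\<^bsub>\<Gamma>\<^esub> s \<otimes>\<^bsub>\<Gamma>\<^esub> inv\<^bsub>\<Gamma>\<^esub> (rep (c #>\<^bsub>\<Gamma>\<^esub> s))"

definition transfer :: "('g \<Rightarrow> 'm) \<Rightarrow> 'g \<Rightarrow> 'm" where
  "transfer f s = (\<Otimes>\<^bsub>M\<^esub>c\<in>rcosets\<^bsub>\<Gamma>\<^esub> \<Delta>. act (inv\<^bsub>\<Gamma>\<^esub> (rep c)) (f (coset_factor c s)))"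

text \<open>
  The norm from \<open>\<Delta>\<close> to \<open>\<Gamma>\<close>, except that \<open>b\<close> need not be fixed by \<open>\<Delta>\<close>; in general the value depends on
  the chosen representatives.
\<close>

definition coset_norm :: "'m \<Rightarrow> 'm" where
  "coset_norm b = (\<Otimes>\<^bsub>M\<^esub>c\<in>rcosets\<^bsub>\<Gamma>\<^esub> \<Delta>. act (inv\<^bsub>\<Gamma>\<^esub> (rep c)) b)"

lemma \<Delta>_subset: "\<Delta> \<subseteq> carrier \<Gamma>"
  by (rule subgroup.subset[OF \<Delta>])

lemma rep_mem:
  assumes "c \<in> rcosets\<^bsub>\<Gamma>\<^esub> \<Delta>"
  shows "rep c \<in> c" "rep c \<in> carrier \<Gamma>" "\<Delta> #>\<^bsub>\<Gamma>\<^esub> rep c = c"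
proof -
  obtain x where x: "x \<in> carrier \<Gamma>" "c = \<Delta> #>\<^bsub>\<Gamma>\<^esub> x"
    using assms by (auto simp: RCOSETS_def)
  have "x \<in> c" using \<Gamma>.rcos_self[OF x(1) \<Delta>] x(2) by simp
  then show m: "rep c \<in> c" unfolding rep_def by (rule someI)
  then show "rep c \<in> carrier \<Gamma>"
    using subgroup.elemrcos_carrier[OF \<Delta> \<Gamma>.is_group x(1)] x(2) by blast
  show "\<Delta> #>\<^bsub>\<Gamma>\<^esub> rep c = c"
    using \<Gamma>.repr_independence[OF _ x(1) \<Delta>] m x(2) by simp
qed

lemma rcosets_shift:
  assumes "c \<in> rcosets\<^bsub>\<Gamma>\<^esub> \<Delta>" "s \<in> carrier \<Gamma>"
  shows "c #>\<^bsub>\<Gamma>\<^esub> s \<in> rcosets\<^bsub>\<Gamma>\<^esub> \<Delta>" "c #>\<^bsub>\<Gamma>\<^esub> s = \<Delta> #>\<^bsub>\<Gamma>\<^esub> (rep c \<otimes>\<^bsub>\<Gamma>\<^esub> s)"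
proof -
  show eq: "c #>\<^bsub>\<Gamma>\<^esub> s = \<Delta> #>\<^bsub>\<Gamma>\<^esub> (rep c \<otimes>\<^bsub>\<Gamma>\<^esub> s)"
    using \<Gamma>.coset_mult_assoc[OF \<Delta>_subset rep_mem(2)[OF assms(1)] assms(2)] rep_mem(3)[OF assms(1)]
    by simp
  show "c #>\<^bsub>\<Gamma>\<^esub> s \<in> rcosets\<^bsub>\<Gamma>\<^esub> \<Delta>"
    unfolding eq by (rule \<Gamma>.rcosetsI[OF \<Delta>_subset]) (simp add: assms rep_mem)
qed

lemma rcosets_shift_cancel:
  assumes "c \<in> rcosets\<^bsub>\<Gamma>\<^esub> \<Delta>" "s \<in> carrier \<Gamma>" "t \<in> carrier \<Gamma>" "s \<otimes>\<^bsub>\<Gamma>\<^esub> t = \<one>\<^bsub>\<Gamma>\<^esub>"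
  shows "c #>\<^bsub>\<Gamma>\<^esub> s #>\<^bsub>\<Gamma>\<^esub> t = c"
proof -
  have "c \<subseteq> carrier \<Gamma>"
    by (rule subgroup.rcosets_carrier[OF \<Delta> \<Gamma>.is_group assms(1)])
  then show ?thesis
    using \<Gamma>.coset_mult_assoc[of c s t] \<Gamma>.coset_mult_one[of c] assms by simp
qed

lemma rcosets_shift_bij:
  assumes "s \<in> carrier \<Gamma>"
  shows "bij_betw (\<lambda>c. c #>\<^bsub>\<Gamma>\<^esub> s) (rcosets\<^bsub>\<Gamma>\<^esub> \<Delta>) (rcosets\<^bsub>\<Gamma>\<^esub> \<Delta>)"
  by (rule bij_betw_byWitness[where f' = "\<lambda>c. c #>\<^bsub>\<Gamma>\<^esub> inv\<^bsub>\<Gamma>\<^esub> s"])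
    (use assms rcosets_shift(1) rcosets_shift_cancel in auto)

lemma coset_factor_mem:
  assumes "c \<in> rcosets\<^bsub>\<Gamma>\<^esub> \<Delta>" "s \<in> carrier \<Gamma>"
  shows "coset_factor c s \<in> \<Delta>"
proof -
  note c' = rcosets_shift[OF assms]
  have "rep c \<otimes>\<^bsub>\<Gamma>\<^esub> s \<in> c #>\<^bsub>\<Gamma>\<^esub> s"
    unfolding c'(2) by (rule \<Gamma>.rcos_self[OF _ \<Delta>]) (simp add: assms rep_mem)
  then have "rep c \<otimes>\<^bsub>\<Gamma>\<^esub> s \<in> \<Delta> #>\<^bsub>\<Gamma>\<^esub> rep (c #>\<^bsub>\<Gamma>\<^esub> s)"
    unfolding rep_mem(3)[OF c'(1)] .
  then show ?thesis
    unfolding coset_factor_def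
    by (rule subgroup.rcos_module_imp[OF \<Delta> \<Gamma>.is_group rep_mem(2)[OF c'(1)]])
qed

lemma transfer_closed:
  assumes "f \<in> \<Delta> \<rightarrow> carrier M" "s \<in> carrier \<Gamma>"
  shows "transfer f s \<in> carrier M"
  unfolding transfer_def
  using assms coset_factor_mem by (intro M.finprod_closed Pi_I act_closed) (auto simp: rep_mem)

lemma coset_norm_closed: "b \<in> carrier M \<Longrightarrow> coset_norm b \<in> carrier M"
  unfolding coset_norm_def by (intro M.finprod_closed Pi_I act_closed) (auto simp: rep_mem)

lemma act_finprod:
  assumes s: "s \<in> carrier \<Gamma>" and h: "h \<in> A \<rightarrow> carrier M"
  shows "act s (finprod M h A) = (\<Otimes>\<^bsub>M\<^esub>c\<in>A. act s (h c))"
proof -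
  have one: "act s \<one>\<^bsub>M\<^esub> = \<one>\<^bsub>M\<^esub>"
    using act_mult[OF s, of "\<one>\<^bsub>M\<^esub>" "\<one>\<^bsub>M\<^esub>"] act_closed[OF s, of "\<one>\<^bsub>M\<^esub>"] M.l_cancel_one' by auto
  show ?thesis
    using h
  proof (induction A rule: infinite_finite_induct)
    case (insert a A)
    then show ?case
      using act_closed[OF s] act_mult[OF s] by (simp add: Pi_iff)
  qed (simp_all add: one)
qed

lemma act_inv:
  assumes s: "s \<in> carrier \<Gamma>" and a: "a \<in> carrier M"
  shows "act s (inv\<^bsub>M\<^esub> a) = inv\<^bsub>M\<^esub> (act s a)"
proof -
  have one: "act s \<one>\<^bsub>M\<^esub> = \<one>\<^bsub>M\<^esub>"
    using act_mult[OF s, of "\<one>\<^bsub>M\<^esub>" "\<one>\<^bsub>M\<^esub>"] act_closed[OF s, of "\<one>\<^bsub>M\<^esub>"] M.l_cancel_one' by auto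
  show ?thesis
    using act_mult[OF s, of "inv\<^bsub>M\<^esub> a" a] act_closed[OF s] a one
    by (intro M.inv_equality[symmetric]) simp_all
qed

text \<open>
  Corestriction respects coboundaries.  For a coset \<open>c\<close> with representative \<open>t\<close>, let \<open>u\<close> represent the
  coset \<open>cs\<close> and let \<open>d\<close> be the coset factor, so that \<open>t\<inverse>d = su\<inverse>\<close>.  Applying \<open>t\<inverse>\<close> to the factor \<open>d\<cdot>b\<close>
  yields \<open>s\<close> applied to \<open>u\<inverse>\<cdot>b\<close>, the factor of the norm that belongs to \<open>cs\<close>.  Translation by \<open>s\<close>
  permutes the cosets, so these factors multiply to \<open>s\<close> applied to the norm.
\<close>

lemma transfer_coboundary:
  assumes f: "f \<in> \<Delta> \<rightarrow> carrier M" and b: "b \<in> carrier M" and s: "s \<in> carrier \<Gamma>"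
    and g: "\<And>d. d \<in> \<Delta> \<Longrightarrow> g d = inv\<^bsub>M\<^esub> b \<otimes>\<^bsub>M\<^esub> f d \<otimes>\<^bsub>M\<^esub> act d b"
  shows "transfer g s = inv\<^bsub>M\<^esub> (coset_norm b) \<otimes>\<^bsub>M\<^esub> transfer f s \<otimes>\<^bsub>M\<^esub> act s (coset_norm b)"
proof -
  let ?R = "rcosets\<^bsub>\<Gamma>\<^esub> \<Delta>"
  \<comment> \<open>\<open>h\<close> collects the factors of the norm of \<open>b\<close>, \<open>F\<close> those of the transfer of \<open>f\<close>.\<close>
  define h where "h c = act (inv\<^bsub>\<Gamma>\<^esub> (rep c)) b" for c
  define F where "F c = act (inv\<^bsub>\<Gamma>\<^esub> (rep c)) (f (coset_factor c s))" for c
  have h: "h c \<in> carrier M" if "c \<in> ?R" for c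
    using that b by (simp add: h_def act_closed rep_mem)
  have hs: "h (c #>\<^bsub>\<Gamma>\<^esub> s) \<in> carrier M" if "c \<in> ?R" for c
    using h rcosets_shift(1)[OF that s] by simp
  have F: "F c \<in> carrier M" if "c \<in> ?R" for c
    using that f coset_factor_mem[OF that s] by (auto simp: F_def rep_mem intro!: act_closed)
  have factor: "act (inv\<^bsub>\<Gamma>\<^esub> (rep c)) (g (coset_factor c s)) =
      inv\<^bsub>M\<^esub> (h c) \<otimes>\<^bsub>M\<^esub> F c \<otimes>\<^bsub>M\<^esub> act s (h (c #>\<^bsub>\<Gamma>\<^esub> s))" if c: "c \<in> ?R" for c
  proof -
    let ?t = "rep c" and ?u = "rep (c #>\<^bsub>\<Gamma>\<^esub> s)" and ?d = "coset_factor c s"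
    have t: "?t \<in> carrier \<Gamma>" and u: "?u \<in> carrier \<Gamma>"
      using rep_mem(2) c rcosets_shift(1)[OF c s] by auto
    have d: "?d \<in> \<Delta>" "?d \<in> carrier \<Gamma>"
      using coset_factor_mem[OF c s] \<Delta>_subset by auto
    have fd: "f ?d \<in> carrier M" using f d by auto
    have "inv\<^bsub>\<Gamma>\<^esub> ?t \<otimes>\<^bsub>\<Gamma>\<^esub> ?d = s \<otimes>\<^bsub>\<Gamma>\<^esub> inv\<^bsub>\<Gamma>\<^esub> ?u"
      using t u s by (simp add: coset_factor_def \<Gamma>.m_assoc flip: \<Gamma>.m_assoc[of "inv\<^bsub>\<Gamma>\<^esub> ?t" ?t])
    then have "act (inv\<^bsub>\<Gamma>\<^esub> ?t) (act ?d b) = act s (h (c #>\<^bsub>\<Gamma>\<^esub> s))"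
      using t u s d b by (simp add: h_def flip: act_act)
    then show ?thesis
      using t b fd d by (simp add: g h_def F_def act_mult act_closed act_inv)
  qed
  have "transfer g s = (\<Otimes>\<^bsub>M\<^esub>c\<in>?R. inv\<^bsub>M\<^esub> (h c) \<otimes>\<^bsub>M\<^esub> F c \<otimes>\<^bsub>M\<^esub> act s (h (c #>\<^bsub>\<Gamma>\<^esub> s)))"
    unfolding transfer_def
    by (rule M.finprod_cong') (use factor h hs F act_closed[OF s] in auto)
  also have "\<dots> = (\<Otimes>\<^bsub>M\<^esub>c\<in>?R. inv\<^bsub>M\<^esub> (h c)) \<otimes>\<^bsub>M\<^esub> transfer f s \<otimes>\<^bsub>M\<^esub> (\<Otimes>\<^bsub>M\<^esub>c\<in>?R. act s (h (c #>\<^bsub>\<Gamma>\<^esub> s)))"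
    unfolding transfer_def F_def[symmetric]
    by (subst M.finprod_multf, (use h hs F act_closed[OF s] in auto)[2])+ simp
  also have "(\<Otimes>\<^bsub>M\<^esub>c\<in>?R. inv\<^bsub>M\<^esub> (h c)) = inv\<^bsub>M\<^esub> (coset_norm b)"
  proof (rule M.inv_equality[symmetric])
    have "(\<Otimes>\<^bsub>M\<^esub>c\<in>?R. inv\<^bsub>M\<^esub> (h c)) \<otimes>\<^bsub>M\<^esub> (\<Otimes>\<^bsub>M\<^esub>c\<in>?R. h c) = (\<Otimes>\<^bsub>M\<^esub>c\<in>?R. inv\<^bsub>M\<^esub> (h c) \<otimes>\<^bsub>M\<^esub> h c)"
      by (rule M.finprod_multf[symmetric]) (use h in auto)
    also have "\<dots> = \<one>\<^bsub>M\<^esub>"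
      by (rule M.finprod_one_eqI) (use h in auto)
    finally show "(\<Otimes>\<^bsub>M\<^esub>c\<in>?R. inv\<^bsub>M\<^esub> (h c)) \<otimes>\<^bsub>M\<^esub> coset_norm b = \<one>\<^bsub>M\<^esub>"
      by (simp add: coset_norm_def h_def)
  qed (use h coset_norm_closed[OF b] in auto)
  also have "(\<Otimes>\<^bsub>M\<^esub>c\<in>?R. act s (h (c #>\<^bsub>\<Gamma>\<^esub> s))) = act s (\<Otimes>\<^bsub>M\<^esub>c\<in>?R. h (c #>\<^bsub>\<Gamma>\<^esub> s))"
    by (rule act_finprod[OF s, symmetric]) (use hs in auto)
  also have "(\<Otimes>\<^bsub>M\<^esub>c\<in>?R. h (c #>\<^bsub>\<Gamma>\<^esub> s)) = coset_norm b"
  proof -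
    note bij = rcosets_shift_bij[OF s, unfolded bij_betw_def]
    have "(\<Otimes>\<^bsub>M\<^esub>c\<in>?R. h (c #>\<^bsub>\<Gamma>\<^esub> s)) = finprod M h ((\<lambda>c. c #>\<^bsub>\<Gamma>\<^esub> s) ` ?R)"
      by (rule M.finprod_reindex[symmetric]) (use bij h in auto)
    also have "\<dots> = coset_norm b"
      using bij by (simp add: coset_norm_def h_def[abs_def])
    finally show ?thesis .
  qed
  finally show ?thesis .
qed

end

section \<open>Cocycles\<close>

text \<open>
  The right-hand side mentions the discrete target only through the image of \<open>f\<close>.  This is what allows
  a cocycle to be moved from one coefficient group to another.
\<close>

lemma continuous_map_discrete_iff:
  "continuous_map Y (discrete_topology S) f \<longleftrightarrow>
    f ` topspace Y \<subseteq> S \<and>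
    (\<forall>x\<in>topspace Y. \<exists>T. openin Y T \<and> x \<in> T \<and> (\<forall>y\<in>T. f y = f x))" (is "?cont \<longleftrightarrow> ?loc")
proof
  assume L: ?cont
  have "openin Y {y \<in> topspace Y. f y \<in> {f x}}" if "x \<in> topspace Y" for x
    using L that by (intro openin_continuous_map_preimage[OF L]) (auto simp: continuous_map_def)
  moreover have "f ` topspace Y \<subseteq> S"
    using L by (auto simp: continuous_map_def)
  ultimately show ?loc
    by (intro conjI ballI exI[where x = "{y \<in> topspace Y. f y \<in> {f _}}"]) auto
next
  assume R: ?loc
  have "openin Y {x \<in> topspace Y. f x \<in> U}" for U
  proof (subst openin_subopen, intro ballI)
    fix x assume x: "x \<in> {x \<in> topspace Y. f x \<in> U}"
    then obtain T where T: "openin Y T" "x \<in> T" "\<forall>y\<in>T. f y = f x" using R by blast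
    have "T \<subseteq> {x \<in> topspace Y. f x \<in> U}"
    proof
      fix y assume y: "y \<in> T"
      then have "f y \<in> U" using T(3) x by (metis (mono_tags, lifting) mem_Collect_eq)
      then show "y \<in> {x \<in> topspace Y. f x \<in> U}" using y openin_subset[OF T(1)] by blast
    qed
    then show "\<exists>T. openin Y T \<and> x \<in> T \<and> T \<subseteq> {x \<in> topspace Y. f x \<in> U}"
      using T by blast
  qed
  moreover have "f \<in> topspace Y \<rightarrow> S" using R by blast
  ultimately show ?cont by (simp add: continuous_map_def)
qed

lemma cocycles_change_target:
  assumes "f \<in> cocycles \<Omega> F H" "\<And>\<sigma>. \<sigma> \<in> Gal \<Omega> F \<Longrightarrow> f \<sigma> \<in> rational_points \<Omega> H'"
    and "topspace (krull_topology \<Omega> F) \<subseteq> Gal \<Omega> F"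
  shows "f \<in> cocycles \<Omega> F H'"
  using assms unfolding cocycles_def continuous_map_discrete_iff by (auto simp: PiE_iff)

lemma rational_points_mono: "H \<subseteq> H' \<Longrightarrow> rational_points \<Omega> H \<subseteq> rational_points \<Omega> H'"
  by (auto simp: rational_points_def)

lemma cocyclesD:
  assumes "f \<in> cocycles \<Omega> F H"
  shows "\<sigma> \<in> Gal \<Omega> F \<Longrightarrow> f \<sigma> \<in> rational_points \<Omega> H"
    "continuous_map (krull_topology \<Omega> F) (discrete_topology (rational_points \<Omega> H)) f"
    "\<sigma> \<in> Gal \<Omega> F \<Longrightarrow> \<tau> \<in> Gal \<Omega> F \<Longrightarrow>
      f (\<sigma> \<otimes>\<^bsub>Gal_group \<Omega> F\<^esub> \<tau>) = f \<sigma> ** map_matrix \<sigma> (f \<tau>)"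
  using assms unfolding cocycles_def by (blast dest: PiE_mem)+

text \<open>
  The effect on the value at \<open>\<sigma>\<close> when a cocycle is changed by the coboundary of \<open>c\<close>.
\<close>

definition twist :: "'a::field ^ 'n::finite ^ 'n \<Rightarrow> ('a \<Rightarrow> 'a) \<Rightarrow> 'a ^ 'n ^ 'n \<Rightarrow> 'a ^ 'n ^ 'n" where
  "twist c \<sigma> A = matrix_inv c ** A ** map_matrix \<sigma> c"

lemma cohomologous_iff:
  "(f, g) \<in> cohomologous \<Omega> F H \<longleftrightarrow> f \<in> cocycles \<Omega> F H \<and> g \<in> cocycles \<Omega> F H \<and>
    (\<exists>c\<in>rational_points \<Omega> H. \<forall>\<sigma>\<in>Gal \<Omega> F. g \<sigma> = twist c \<sigma> (f \<sigma>))"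
  by (auto simp: cohomologous_def twist_def)

context galois_setting
begin

lemma rational_points_group:
  fixes H :: "('a ^ 'n::finite ^ 'n) set"
  assumes "linear_algebraic_group K H"
  shows "mat 1 \<in> rational_points \<Omega> H"
    "A \<in> rational_points \<Omega> H \<Longrightarrow> invertible A"
    "A \<in> rational_points \<Omega> H \<Longrightarrow> matrix_inv A \<in> rational_points \<Omega> H"
    "A \<in> rational_points \<Omega> H \<Longrightarrow> B \<in> rational_points \<Omega> H \<Longrightarrow> A ** B \<in> rational_points \<Omega> H"
proof -
  note S = subgroup_rational_points[OF assms]
  show "mat 1 \<in> rational_points \<Omega> H"
    using subgroup.one_closed[OF S] by (simp add: GL_def)
  show "invertible A" if "A \<in> rational_points \<Omega> H"
    using subgroup.subset[OF S] that by (auto simp: GL_def)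
  show "matrix_inv A \<in> rational_points \<Omega> H" if "A \<in> rational_points \<Omega> H"
    using subgroup.m_inv_closed[OF S that] subgroup.subset[OF S] that inv_GL[of A] by auto
  show "A ** B \<in> rational_points \<Omega> H" if "A \<in> rational_points \<Omega> H" "B \<in> rational_points \<Omega> H"
    using subgroup.m_closed[OF S that] by (simp add: GL_def)
qed

lemma map_matrix_mult_rational:
  assumes "\<sigma> \<in> Gal \<Omega> K" "A \<in> rational_points \<Omega> H" "B \<in> rational_points \<Omega> H"
  shows "map_matrix \<sigma> (A ** B) = map_matrix \<sigma> A ** map_matrix \<sigma> B"
  by (rule map_matrix_mult) (use assms rational_pointsD(1) in auto)

lemma twist_one:
  fixes A :: "'a ^ 'n::finite ^ 'n"
  assumes "\<sigma> \<in> Gal \<Omega> K"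
  shows "twist (mat 1) \<sigma> A = A"
proof -
  have "invertible (mat 1 :: 'a ^ 'n ^ 'n)"
    unfolding invertible_def using matrix_mul_lid by blast
  then have "matrix_inv (mat 1 :: 'a ^ 'n ^ 'n) = mat 1"
    using matrix_inv_mult(2)[of "mat 1 :: 'a ^ 'n ^ 'n"] by simp
  then show ?thesis
    by (simp add: twist_def map_matrix_one[OF assms])
qed

lemma twist_twist:
  fixes H :: "('a ^ 'n::finite ^ 'n) set"
  assumes H: "linear_algebraic_group K H" and s: "\<sigma> \<in> Gal \<Omega> K"
    and c: "c \<in> rational_points \<Omega> H" and d: "d \<in> rational_points \<Omega> H"
  shows "twist d \<sigma> (twist c \<sigma> A) = twist (c ** d) \<sigma> A"
proof -
  interpret GL: group "GL :: ('a ^ 'n ^ 'n) monoid" by (rule group_GL)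
  have "c \<in> carrier GL" "d \<in> carrier GL"
    using c d subgroup.subset[OF subgroup_rational_points[OF H]] by auto
  then have "matrix_inv (c ** d) = matrix_inv d ** matrix_inv c"
    using GL.inv_mult_group[of c d] GL.m_closed[of c d] by (simp add: inv_GL) (simp add: GL_def)
  then show ?thesis
    by (simp add: twist_def map_matrix_mult_rational[OF s c d] matrix_mul_assoc)
qed

lemma twist_inverse:
  fixes H :: "('a ^ 'n::finite ^ 'n) set"
  assumes H: "linear_algebraic_group K H" and s: "\<sigma> \<in> Gal \<Omega> K" and c: "c \<in> rational_points \<Omega> H"
  shows "twist (matrix_inv c) \<sigma> (twist c \<sigma> A) = A"
  using twist_twist[OF H s c rational_points_group(3)[OF H c]]
    matrix_inv_mult(1)[OF rational_points_group(2)[OF H c]] twist_one[OF s] by simp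

lemma equiv_cohomologous:
  fixes H :: "('a ^ 'n::finite ^ 'n) set"
  assumes H: "linear_algebraic_group K H" and F: "K \<subseteq> F"
  shows "equiv (cocycles \<Omega> F H) (cohomologous \<Omega> F H)"
proof (rule equivI)
  note Gal = subsetD[OF Gal_mono[OF F]]
  note X = rational_points_group[OF H]
  show "cohomologous \<Omega> F H \<subseteq> cocycles \<Omega> F H \<times> cocycles \<Omega> F H"
    by (auto simp: cohomologous_iff)
  show "refl_on (cocycles \<Omega> F H) (cohomologous \<Omega> F H)"
  proof (rule refl_onI)
    fix f assume "f \<in> cocycles \<Omega> F H"
    then show "(f, f) \<in> cohomologous \<Omega> F H"
      using X(1) by (auto simp: cohomologous_iff twist_one[OF Gal] intro!: bexI[of _ "mat 1"])
  qed
  show "sym (cohomologous \<Omega> F H)"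
  proof (rule symI)
    fix f g assume "(f, g) \<in> cohomologous \<Omega> F H"
    then obtain c where "f \<in> cocycles \<Omega> F H" "g \<in> cocycles \<Omega> F H" and c: "c \<in> rational_points \<Omega> H"
      "\<forall>\<sigma>\<in>Gal \<Omega> F. g \<sigma> = twist c \<sigma> (f \<sigma>)" by (auto simp: cohomologous_iff)
    then show "(g, f) \<in> cohomologous \<Omega> F H"
      using X(3) twist_inverse[OF H Gal c(1)]
      by (auto simp: cohomologous_iff intro!: bexI[of _ "matrix_inv c"])
  qed
  show "trans (cohomologous \<Omega> F H)"
  proof (rule transI)
    fix f g h assume "(f, g) \<in> cohomologous \<Omega> F H" "(g, h) \<in> cohomologous \<Omega> F H"
    then obtain c d where "f \<in> cocycles \<Omega> F H" "h \<in> cocycles \<Omega> F H"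
      and c: "c \<in> rational_points \<Omega> H" "\<forall>\<sigma>\<in>Gal \<Omega> F. g \<sigma> = twist c \<sigma> (f \<sigma>)"
      and d: "d \<in> rational_points \<Omega> H" "\<forall>\<sigma>\<in>Gal \<Omega> F. h \<sigma> = twist d \<sigma> (g \<sigma>)"
      by (auto simp: cohomologous_iff)
    then show "(f, h) \<in> cohomologous \<Omega> F H"
      using X(4) twist_twist[OF H Gal c(1) d(1)]
      by (auto simp: cohomologous_iff intro!: bexI[of _ "c ** d"])
  qed
qed

lemma openin_krull_map_matrix:
  fixes c :: "'a ^ 'n::finite ^ 'n"
  assumes c: "\<And>i j. c $ i $ j \<in> \<Omega>"
  shows "openin (krull_topology \<Omega> K) {\<sigma> \<in> Gal \<Omega> K. map_matrix \<sigma> c = B}"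
proof -
  have "{\<sigma> \<in> Gal \<Omega> K. map_matrix \<sigma> c = B} =
      (\<Inter>(i, j)\<in>UNIV. {\<sigma> \<in> Gal \<Omega> K. \<sigma> (c $ i $ j) = B $ i $ j})"
    by (auto simp: vec_eq_iff)
  also have "openin (krull_topology \<Omega> K) \<dots>"
    by (rule openin_INT2) (auto intro!: openin_krull_agree[OF alg_closure subfield_\<Omega> K_le_\<Omega> c])
  finally show ?thesis .
qed

text \<open>
  The two inner factors \<open>\<sigma>(c)\<close> and \<open>\<sigma>(c\<inverse>)\<close> cancel in the product of
  \<open>twist c \<sigma> (f \<sigma>)\<close> with the conjugate of the twisted value at \<open>\<tau>\<close>.  For continuity, both \<open>f\<close> and the
  conjugate of \<open>c\<close> are constant near \<open>\<sigma>\<close>.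
\<close>

lemma twist_cocycle:
  fixes H :: "('a ^ 'n::finite ^ 'n) set"
  assumes H: "linear_algebraic_group K H" and f: "f \<in> cocycles \<Omega> K H" and c: "c \<in> rational_points \<Omega> H"
  shows "(\<lambda>\<sigma>\<in>Gal \<Omega> K. twist c \<sigma> (f \<sigma>)) \<in> cocycles \<Omega> K H" (is "?g \<in> _")
proof -
  interpret \<Gamma>: group "Gal_group \<Omega> K" by (rule group_Gal_group[OF subfield_\<Omega> K_le_\<Omega>])
  note X = rational_points_group[OF H] and gal = Gal_rational_points[OF H]
  note top = topspace_krull_topology[OF subfield_\<Omega> K_le_\<Omega>]
  note fX = cocyclesD(1)[OF f]
  note ci = X(3)[OF c]
  have gX: "twist c \<sigma> (f \<sigma>) \<in> rational_points \<Omega> H" if "\<sigma> \<in> Gal \<Omega> K" for \<sigma>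
    unfolding twist_def using that by (intro X(4) ci fX gal c)
  have "\<exists>T. openin (krull_topology \<Omega> K) T \<and> \<sigma> \<in> T \<and> (\<forall>\<tau>\<in>T. ?g \<tau> = ?g \<sigma>)"
    if s: "\<sigma> \<in> topspace (krull_topology \<Omega> K)" for \<sigma>
  proof -
    obtain T where T: "openin (krull_topology \<Omega> K) T" "\<sigma> \<in> T" "\<forall>\<tau>\<in>T. f \<tau> = f \<sigma>"
      using cocyclesD(2)[OF f] s unfolding continuous_map_discrete_iff by meson
    let ?U = "T \<inter> {\<tau> \<in> Gal \<Omega> K. map_matrix \<tau> c = map_matrix \<sigma> c}"
    have "openin (krull_topology \<Omega> K) ?U"
      using T(1) openin_krull_map_matrix[of c, OF rational_pointsD(1)[OF c]] by (rule openin_Int)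
    moreover have "\<sigma> \<in> ?U" using T(2) s top by auto
    moreover have "?g \<tau> = ?g \<sigma>" if "\<tau> \<in> ?U" for \<tau>
    proof -
      have "f \<tau> = f \<sigma>" "map_matrix \<tau> c = map_matrix \<sigma> c" "\<tau> \<in> Gal \<Omega> K" "\<sigma> \<in> Gal \<Omega> K"
        using that T(3) s top by blast+
      then show ?thesis by (simp only: twist_def restrict_apply')
    qed
    ultimately show ?thesis by blast
  qed
  then have cont: "continuous_map (krull_topology \<Omega> K) (discrete_topology (rational_points \<Omega> H)) ?g"
    unfolding continuous_map_discrete_iff using top gX by (auto simp del: topspace_discrete_topology)
  have "?g (\<sigma> \<otimes>\<^bsub>Gal_group \<Omega> K\<^esub> \<tau>) = ?g \<sigma> ** map_matrix \<sigma> (?g \<tau>)"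
    if s: "\<sigma> \<in> Gal \<Omega> K" and t: "\<tau> \<in> Gal \<Omega> K" for \<sigma> \<tau>
  proof -
    have st: "\<sigma> \<otimes>\<^bsub>Gal_group \<Omega> K\<^esub> \<tau> \<in> Gal \<Omega> K"
      using \<Gamma>.m_closed[of \<sigma> \<tau>] s t by simp
    have cst: "map_matrix (\<sigma> \<otimes>\<^bsub>Gal_group \<Omega> K\<^esub> \<tau>) c = map_matrix \<sigma> (map_matrix \<tau> c)"
      using rational_pointsD(1)[OF c] by (simp add: vec_eq_iff Gal_group_mult[OF s t])
    have fst: "f (\<sigma> \<otimes>\<^bsub>Gal_group \<Omega> K\<^esub> \<tau>) = f \<sigma> ** map_matrix \<sigma> (f \<tau>)"
      by (rule cocyclesD(3)[OF f s t])
    have cc: "map_matrix \<sigma> c ** map_matrix \<sigma> (matrix_inv c) = mat 1"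
      unfolding map_matrix_mult_rational[OF s c ci, symmetric] matrix_inv_mult(1)[OF X(2)[OF c]]
      by (rule map_matrix_one[OF s])
    have "map_matrix \<sigma> (twist c \<tau> (f \<tau>)) =
        map_matrix \<sigma> (matrix_inv c) ** map_matrix \<sigma> (f \<tau>) ** map_matrix \<sigma> (map_matrix \<tau> c)"
      unfolding twist_def
      using map_matrix_mult_rational[OF s X(4)[OF ci fX[OF t]] gal[OF t c]] map_matrix_mult_rational[OF s ci fX[OF t]] by simp
    then have "twist c \<sigma> (f \<sigma>) ** map_matrix \<sigma> (twist c \<tau> (f \<tau>)) =
        matrix_inv c ** f \<sigma> ** (map_matrix \<sigma> c ** map_matrix \<sigma> (matrix_inv c))
          ** map_matrix \<sigma> (f \<tau>) ** map_matrix \<sigma> (map_matrix \<tau> c)"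
      by (simp add: twist_def matrix_mul_assoc)
    also have "\<dots> = twist c (\<sigma> \<otimes>\<^bsub>Gal_group \<Omega> K\<^esub> \<tau>) (f (\<sigma> \<otimes>\<^bsub>Gal_group \<Omega> K\<^esub> \<tau>))"
      by (simp add: cc twist_def fst cst matrix_mul_assoc)
    finally show ?thesis using s t st by simp
  qed
  then show ?thesis
    using gX cont by (simp add: cocycles_def)
qed

lemma H1_incl_class:
  fixes Z H :: "('a ^ 'n::finite ^ 'n) set"
  assumes H: "linear_algebraic_group K H" and F: "K \<subseteq> F" "F \<subseteq> \<Omega>"
    and Z: "Z \<subseteq> H" and f: "f \<in> cocycles \<Omega> F Z" and eq: "equiv (cocycles \<Omega> F Z) (cohomologous \<Omega> F Z)"
  shows "H1_incl \<Omega> F H (cohomologous \<Omega> F Z `` {f}) = cohomologous \<Omega> F H `` {f}"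
proof -
  note eqH = equiv_cohomologous[OF H F(1)]
  note XH = rational_points_mono[OF Z, of \<Omega>]
  have coc: "g \<in> cocycles \<Omega> F H" if "g \<in> cocycles \<Omega> F Z" for g
    by (rule cocycles_change_target[OF that _ topspace_krull_topology[OF subfield_\<Omega> F(2)]])
      (use cocyclesD(1)[OF that] XH in auto)
  have "(f, g) \<in> cohomologous \<Omega> F H" if "(f, g) \<in> cohomologous \<Omega> F Z" for g
    using that coc XH by (auto simp: cohomologous_iff)
  moreover have "(f, f) \<in> cohomologous \<Omega> F Z"
    using f equiv_class_self[OF eq] by blast
  ultimately show ?thesis
    unfolding H1_incl_def using equivE[OF eqH] by (blast dest: transD)
qed

end

section \<open>Corestriction and the norm principle\<close>

abbreviation rational_group :: "'a set \<Rightarrow> ('a::field ^ 'n::finite ^ 'n) set \<Rightarrow> ('a ^ 'n ^ 'n) monoid" where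
  "rational_group \<Omega> Z \<equiv> GL\<lparr>carrier := rational_points \<Omega> Z\<rparr>"

locale corestriction_setting = galois_setting +
  fixes L :: "'a::field set" and G :: "('a ^ 'n::finite ^ 'n) set"
  assumes fin_sep: "finite_separable_extension K L"
begin

lemma K_le_L: "K \<subseteq> L" and L_le_\<Omega>: "L \<subseteq> \<Omega>"
  using fin_sep separable_extension_le_separable_closure[OF sep_closure fin_sep]
  by (auto simp: finite_separable_extension_def)

lemma comm_group_rational_points:
  assumes Z: "central_subgroup K Z G"
  shows "comm_group (rational_group \<Omega> Z)"
proof -
  have "linear_algebraic_group K Z" using Z by (simp add: central_subgroup_def)
  then have "group (rational_group \<Omega> Z)"
    by (intro subgroup.subgroup_is_group[OF _ group_GL] subgroup_rational_points)
  then show ?thesis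
    by (rule group.group_comm_groupI)
      (use Z in \<open>auto simp: central_subgroup_def rational_points_def GL_def\<close>)
qed

lemma transfer_rational_points:
  assumes Z: "central_subgroup K Z G"
  shows "coset_transfer (Gal_group \<Omega> K) (rational_group \<Omega> Z) (Gal \<Omega> L) map_matrix"
proof -
  interpret \<Gamma>: group "Gal_group \<Omega> K" by (rule group_Gal_group[OF subfield_\<Omega> K_le_\<Omega>])
  interpret M: comm_group "rational_group \<Omega> Z" by (rule comm_group_rational_points[OF Z])
  have lag: "linear_algebraic_group K Z" using Z by (simp add: central_subgroup_def)
  show ?thesis
  proof (intro coset_transfer.intro coset_transfer_axioms.intro \<Gamma>.is_group M.comm_group_axioms)
    show "subgroup (Gal \<Omega> L) (Gal_group \<Omega> K)"
      by (rule subgroup_Gal_Gal[OF subfield_\<Omega> K_le_L L_le_\<Omega>])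
  next
    fix \<sigma> A assume "\<sigma> \<in> carrier (Gal_group \<Omega> K)" "A \<in> carrier (rational_group \<Omega> Z)"
    then show "map_matrix \<sigma> A \<in> carrier (rational_group \<Omega> Z)"
      using Gal_rational_points[OF lag] by simp
  next
    fix \<sigma> A B assume "\<sigma> \<in> carrier (Gal_group \<Omega> K)" "A \<in> carrier (rational_group \<Omega> Z)"
      "B \<in> carrier (rational_group \<Omega> Z)"
    then show "map_matrix \<sigma> (A \<otimes>\<^bsub>rational_group \<Omega> Z\<^esub> B) =
        map_matrix \<sigma> A \<otimes>\<^bsub>rational_group \<Omega> Z\<^esub> map_matrix \<sigma> B"
      using map_matrix_mult_rational[of \<sigma> A Z B] by (simp add: GL_def)
  next
    fix \<sigma> \<tau> and A :: "'a ^ 'n ^ 'n"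
    assume "\<sigma> \<in> carrier (Gal_group \<Omega> K)" "\<tau> \<in> carrier (Gal_group \<Omega> K)"
      "A \<in> carrier (rational_group \<Omega> Z)"
    then show "map_matrix (\<sigma> \<otimes>\<^bsub>Gal_group \<Omega> K\<^esub> \<tau>) A = map_matrix \<sigma> (map_matrix \<tau> A)"
      by (simp add: vec_eq_iff Gal_group_mult rational_pointsD(1))
  qed
qed

lemma cores_cochain_transfer:
  assumes Z: "central_subgroup K Z G" and "\<sigma> \<in> Gal \<Omega> K"
  shows "cores_cochain \<Omega> L K Z f \<sigma> =
    coset_transfer.transfer (Gal_group \<Omega> K) (rational_group \<Omega> Z) (Gal \<Omega> L) map_matrix f \<sigma>"
proof -
  interpret coset_transfer "Gal_group \<Omega> K" "rational_group \<Omega> Z" "Gal \<Omega> L" map_matrix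
    by (rule transfer_rational_points[OF Z])
  show ?thesis
    using assms(2) by (simp add: cores_cochain_def transfer_def coset_factor_def rep_def Let_def)
qed

lemma cores_cochain_closed:
  assumes Z: "central_subgroup K Z G" and f: "f \<in> Gal \<Omega> L \<rightarrow> rational_points \<Omega> Z" and s: "\<sigma> \<in> Gal \<Omega> K"
  shows "cores_cochain \<Omega> L K Z f \<sigma> \<in> rational_points \<Omega> Z"
proof -
  interpret coset_transfer "Gal_group \<Omega> K" "rational_group \<Omega> Z" "Gal \<Omega> L" map_matrix
    by (rule transfer_rational_points[OF Z])
  show ?thesis
    using transfer_closed[of f \<sigma>] f s by (simp add: cores_cochain_transfer[OF Z s])
qed

lemma cores_cochain_twist:
  assumes Z: "central_subgroup K Z G" and f: "f \<in> Gal \<Omega> L \<rightarrow> rational_points \<Omega> Z"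
    and b: "b \<in> rational_points \<Omega> Z" and g: "\<And>\<sigma>. \<sigma> \<in> Gal \<Omega> L \<Longrightarrow> g \<sigma> = twist b \<sigma> (f \<sigma>)"
  obtains N where "N \<in> rational_points \<Omega> Z"
    "\<And>\<sigma>. \<sigma> \<in> Gal \<Omega> K \<Longrightarrow> cores_cochain \<Omega> L K Z g \<sigma> = twist N \<sigma> (cores_cochain \<Omega> L K Z f \<sigma>)"
proof -
  interpret coset_transfer "Gal_group \<Omega> K" "rational_group \<Omega> Z" "Gal \<Omega> L" map_matrix
    by (rule transfer_rational_points[OF Z])
  have lag: "linear_algebraic_group K Z" using Z by (simp add: central_subgroup_def)
  note S = subgroup_rational_points[OF lag]
  have inv: "inv\<^bsub>rational_group \<Omega> Z\<^esub> c = matrix_inv c" if "c \<in> rational_points \<Omega> Z" for c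
    using group.m_inv_consistent[OF group_GL S that] inv_GL[of c] subgroup.subset[OF S] that by auto
  define N where "N = coset_norm b"
  have N: "N \<in> rational_points \<Omega> Z"
    using coset_norm_closed[of b] b by (simp add: N_def)
  have "cores_cochain \<Omega> L K Z g \<sigma> = twist N \<sigma> (cores_cochain \<Omega> L K Z f \<sigma>)" if "\<sigma> \<in> Gal \<Omega> K" for \<sigma>
    unfolding cores_cochain_transfer[OF Z that]
    using transfer_coboundary[of f b \<sigma> g] f b g that N
    by (simp add: inv twist_def flip: N_def) (simp add: GL_def)
  then show thesis using N that by blast
qed

lemma cores_cochain_change_target:
  assumes Z: "central_subgroup K Z G" and Z': "central_subgroup K Z' G" and le: "Z \<subseteq> Z'"
    and fv: "f \<in> Gal \<Omega> L \<rightarrow> rational_points \<Omega> Z"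
  shows "cores_cochain \<Omega> L K Z f = cores_cochain \<Omega> L K Z' f"
proof -
  interpret T: coset_transfer "Gal_group \<Omega> K" "rational_group \<Omega> Z" "Gal \<Omega> L" map_matrix
    by (rule transfer_rational_points[OF Z])
  interpret T': coset_transfer "Gal_group \<Omega> K" "rational_group \<Omega> Z'" "Gal \<Omega> L" map_matrix
    by (rule transfer_rational_points[OF Z'])
  have lag: "linear_algebraic_group K Z" "linear_algebraic_group K Z'"
    using Z Z' by (auto simp: central_subgroup_def)
  have sub: "subgroup (rational_points \<Omega> Z) (rational_group \<Omega> Z')"
    using rational_points_mono[OF le]
    by (intro group.subgroup_incl[OF group_GL] subgroup_rational_points lag) auto
  have "cores_cochain \<Omega> L K Z f \<sigma> = cores_cochain \<Omega> L K Z' f \<sigma>" if s: "\<sigma> \<in> Gal \<Omega> K" for \<sigma>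
  proof -
    have "map_matrix (inv\<^bsub>Gal_group \<Omega> K\<^esub> T.rep c) (f (T.coset_factor c \<sigma>)) \<in> rational_points \<Omega> Z"
      if "c \<in> rcosets\<^bsub>Gal_group \<Omega> K\<^esub> Gal \<Omega> L" for c
    proof -
      have "f (T.coset_factor c \<sigma>) \<in> rational_points \<Omega> Z"
        using T.coset_factor_mem[OF that, of \<sigma>] s fv by auto
      then show ?thesis
        using T.act_closed[OF T.\<Gamma>.inv_closed[OF T.rep_mem(2)[OF that]]] by simp
    qed
    then have "T.transfer f \<sigma> = T'.transfer f \<sigma>"
      using T'.M.finprod_subgroup[OF sub, of "\<lambda>c. map_matrix (inv\<^bsub>Gal_group \<Omega> K\<^esub> T.rep c) (f (T.coset_factor c \<sigma>))"
          "rcosets\<^bsub>Gal_group \<Omega> K\<^esub> Gal \<Omega> L"]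
      by (simp add: T.transfer_def T'.transfer_def Pi_iff)
    then show ?thesis
      by (simp add: cores_cochain_transfer[OF Z s] cores_cochain_transfer[OF Z' s])
  qed
  then show ?thesis
    by (auto simp: cores_cochain_def fun_eq_iff restrict_def)
qed

text \<open>
  The corestriction of any member of \<open>C\<close> differs from that of \<open>f\<close> by a coboundary, hence is a cocycle
  because the corestriction of \<open>f\<close> is one, and lies in the same class.
\<close>

lemma cores_class:
  assumes Z: "central_subgroup K Z G" and f: "f \<in> cocycles \<Omega> L Z"
    and C: "C = cohomologous \<Omega> L Z `` {f}" and cf: "cores_cochain \<Omega> L K Z f \<in> cocycles \<Omega> K Z"
  shows "cores \<Omega> L K Z C = cohomologous \<Omega> K Z `` {cores_cochain \<Omega> L K Z f}"
proof -
  have lag: "linear_algebraic_group K Z" using Z by (simp add: central_subgroup_def)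
  note eqL = equiv_cohomologous[OF lag K_le_L] and eqK = equiv_cohomologous[OF lag order_refl]
  have "(cores_cochain \<Omega> L K Z f, cores_cochain \<Omega> L K Z g) \<in> cohomologous \<Omega> K Z" if g: "g \<in> C" for g
  proof -
    obtain b where b: "b \<in> rational_points \<Omega> Z" "\<forall>\<sigma>\<in>Gal \<Omega> L. g \<sigma> = twist b \<sigma> (f \<sigma>)"
      using g C by (auto simp: cohomologous_iff)
    obtain N where N: "N \<in> rational_points \<Omega> Z"
      "\<And>\<sigma>. \<sigma> \<in> Gal \<Omega> K \<Longrightarrow> cores_cochain \<Omega> L K Z g \<sigma> = twist N \<sigma> (cores_cochain \<Omega> L K Z f \<sigma>)"
      by (rule cores_cochain_twist[OF Z _ b(1), of f g]) (use b(2) cocyclesD(1)[OF f] in auto)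
    have "cores_cochain \<Omega> L K Z g = (\<lambda>\<sigma>\<in>Gal \<Omega> K. twist N \<sigma> (cores_cochain \<Omega> L K Z f \<sigma>))"
      using N(2) by (auto simp: fun_eq_iff cores_cochain_def)
    then have "cores_cochain \<Omega> L K Z g \<in> cocycles \<Omega> K Z"
      using twist_cocycle[OF lag cf N(1)] by simp
    then show ?thesis
      using cf N by (auto simp: cohomologous_iff)
  qed
  moreover have "f \<in> C"
    using C equiv_class_self[OF eqL f] by simp
  ultimately show ?thesis
    unfolding cores_def using equivE[OF eqK] by (blast dest: transD)
qed

lemma H1_norm_principle_subgroup:
  assumes G: "linear_algebraic_group K G"
    and Z: "central_subgroup K Z G" and Z': "central_subgroup K Z' G" and le: "Z \<subseteq> Z'"
    and norm: "H1_norm_principle \<Omega> L K Z' G"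
  shows "H1_norm_principle \<Omega> L K Z G"
  unfolding H1_norm_principle_def
proof (intro image_subsetI)
  fix C assume C: "C \<in> H1_kernel \<Omega> L Z G"
  have lag: "linear_algebraic_group K Z" "linear_algebraic_group K Z'" and ZG: "Z \<subseteq> G" "Z' \<subseteq> G"
    using Z Z' by (auto simp: central_subgroup_def)
  note eqL = equiv_cohomologous[OF lag(1) K_le_L] and eqK = equiv_cohomologous[OF lag(1) order_refl]
  note eqL' = equiv_cohomologous[OF lag(2) K_le_L] and eqK' = equiv_cohomologous[OF lag(2) order_refl]
  note top = topspace_krull_topology[OF subfield_\<Omega>]
  let ?cor = "cores_cochain \<Omega> L K Z'"
  obtain f where f: "f \<in> cocycles \<Omega> L Z" and Cf: "C = cohomologous \<Omega> L Z `` {f}"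
    using C by (auto simp: H1_kernel_def H1_def elim: quotientE)
  have fv: "f \<in> Gal \<Omega> L \<rightarrow> rational_points \<Omega> Z" using cocyclesD(1)[OF f] by blast
  have f': "f \<in> cocycles \<Omega> L Z'"
    by (rule cocycles_change_target[OF f _ top[OF L_le_\<Omega>]])
      (use fv rational_points_mono[OF le] in auto)
  have cor: "cores_cochain \<Omega> L K Z f = ?cor f"
    by (rule cores_cochain_change_target[OF Z Z' le fv])
  define C' where "C' = cohomologous \<Omega> L Z' `` {f}"
  have "H1_incl \<Omega> L G C' = H1_incl \<Omega> L G C"
    unfolding C'_def Cf
    using H1_incl_class[OF G K_le_L L_le_\<Omega>] f f' eqL eqL' ZG by metis
  then have "C' \<in> H1_kernel \<Omega> L Z' G"
    using C quotientI[OF f', of "cohomologous \<Omega> L Z'"] by (auto simp: H1_kernel_def H1_def C'_def)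
  then have D: "cores \<Omega> L K Z' C' \<in> H1_kernel \<Omega> K Z' G"
    using norm by (auto simp: H1_norm_principle_def)
  \<comment> \<open>The relation \<open>cohomologous\<close> only relates cocycles, so membership in the nonempty class provides a
    \<open>g\<close> whose corestriction is a cocycle.\<close>
  have "cores \<Omega> L K Z' C' \<noteq> {}"
    using D in_quotient_imp_non_empty[OF eqK'] by (auto simp: H1_kernel_def H1_def)
  then obtain g where g: "g \<in> C'" "?cor g \<in> cocycles \<Omega> K Z'"
    by (auto simp: cores_def cohomologous_iff)
  then obtain b where b: "b \<in> rational_points \<Omega> Z'" "\<forall>\<sigma>\<in>Gal \<Omega> L. g \<sigma> = twist b \<sigma> (f \<sigma>)"
    by (auto simp: C'_def cohomologous_iff)
  obtain N where N: "N \<in> rational_points \<Omega> Z'"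
    "\<And>\<sigma>. \<sigma> \<in> Gal \<Omega> K \<Longrightarrow> ?cor g \<sigma> = twist N \<sigma> (?cor f \<sigma>)"
    by (rule cores_cochain_twist[OF Z' _ b(1), of f g]) (use b(2) cocyclesD(1)[OF f'] in auto)
  \<comment> \<open>Undoing the twist by \<open>N\<close> transports the cocycle property from \<open>g\<close> to \<open>f\<close>.\<close>
  have "?cor f = (\<lambda>\<sigma>\<in>Gal \<Omega> K. twist (matrix_inv N) \<sigma> (?cor g \<sigma>))"
  proof
    fix \<sigma> show "?cor f \<sigma> = (\<lambda>\<sigma>\<in>Gal \<Omega> K. twist (matrix_inv N) \<sigma> (?cor g \<sigma>)) \<sigma>"
      using N(2)[of \<sigma>] twist_inverse[OF lag(2) _ N(1)]
      by (cases "\<sigma> \<in> Gal \<Omega> K") (simp_all add: cores_cochain_def)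
  qed
  then have cf': "?cor f \<in> cocycles \<Omega> K Z'"
    using twist_cocycle[OF lag(2) g(2) rational_points_group(3)[OF lag(2) N(1)]] by simp
  \<comment> \<open>The values lie in \<open>Z(\<Omega>)\<close>, since they do so when the product is computed there.\<close>
  have cf: "?cor f \<in> cocycles \<Omega> K Z"
    by (rule cocycles_change_target[OF cf' _ top[OF K_le_\<Omega>]])
      (use cores_cochain_closed[OF Z fv] cor in simp)
  have corC: "cores \<Omega> L K Z C = cohomologous \<Omega> K Z `` {?cor f}"
    using cores_class[OF Z f Cf] cf cor by simp
  have "H1_incl \<Omega> K G (cores \<Omega> L K Z C) = H1_incl \<Omega> K G (cores \<Omega> L K Z' C')"
    unfolding corC cores_class[OF Z' f' C'_def cf']
    using H1_incl_class[OF G order_refl K_le_\<Omega>] cf cf' eqK eqK' ZG by metis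
  then show "cores \<Omega> L K Z C \<in> H1_kernel \<Omega> K Z G"
    using D quotientI[OF cf, of "cohomologous \<Omega> K Z"] corC by (auto simp: H1_kernel_def H1_def)
qed

end

theorem lemma2p2:
  fixes K L \<Omega> :: "'a::field set"
    and G Z\<^sub>1 Z\<^sub>2 :: "('a ^ 'n::finite ^ 'n) set"
  assumes "algebraic_closure (ring_of_type_algebra :: 'a ring) K"
    and "is_separable_closure K \<Omega>"
    and "finite_separable_extension K L"
    and "semisimple_group K G"
    and "central_subgroup K Z\<^sub>1 G"
    and "central_subgroup K Z\<^sub>2 G"
    and "Z\<^sub>1 \<subseteq> Z\<^sub>2"
    and "H1_norm_principle \<Omega> L K Z\<^sub>2 G"
  shows "H1_norm_principle \<Omega> L K Z\<^sub>1 G"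
proof -
  interpret corestriction_setting K \<Omega> L G
    by (rule corestriction_setting.intro[OF galois_setting.intro[OF assms(1,2)]
          corestriction_setting_axioms.intro[OF assms(3)]])
  have "linear_algebraic_group K G"
    using assms(4) by (simp add: semisimple_group_def)
  then show ?thesis
    by (rule H1_norm_principle_subgroup[OF _ assms(5-8)])
qed

end
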